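(* Let $u$ be a strong solution of the Cauchy problem for the thin-film equation $$\partial_t u=-(u\,u_{xxx})_x,\qquad x\in\mathbb{R},\ t>0,\qquad u(\cdot,0)=u_0\ge 0,$$ with initial data satisfying $$\int_{\mathbb{R}} u_0\,\mathrm{d}x = 1,\qquad \int_{\mathbb{R}} x\,u_0\,\mathrm{d}x = 0,\qquad \int_{\mathbb{R}} x^2u_0\,\mathrm{d}x = \Theta_0<+\infty,$$ and $\mathcal{R}_{3/2}(u_0)<+\infty$. Then there exists a constant $C>0$, independent of $u$, such that $$\|u(t)-U_{3/2}(t)\|_{L^1(\mathbb{R})}\leq C\left(\mathcal{R}_{3/2}(u(t)\,|\,U_{3/2}(t))\right)^{1/2}\qquad\text{for all } t>0,$$ where $U_{3/2}(t)$ is the Barenblatt profile of unit mass having the same second moment as $u(t)$, as defined in the context.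
   Context: Let $Q=\mathbb{R}\times(0,\infty)$ and $P=Q\setminus(\{u=0\}\cup\{t=0\})$. A nonnegative function $u$ is a weak solution of the Cauchy problem if $u\in C^{1/2,1/8}(\overline{Q})\cap L^\infty(0,\infty;H^1(\mathbb{R}))\cap C^\infty(P)$, $u^{1/2}u_{xxx}\in L^2(P)$, $$\int_Q u\psi_t+\int_P u\,u_{xxx}\psi_x=0$$ for all Lipschitz functions $\psi$ with compact support inside $Q$, $u(\cdot,0)=u_0$, and $u_x(\cdot,t)\to u_{0x}$ strongly in $L^2(\mathbb{R})$ as $t\downarrow0$. A weak solution is a strong solution if additionally $u\in L^2(0,T;H^2(\mathbb{R}))$ for every $T>0$. Known facts on strong solutions used to make sense of the statement: mass is preserved, and when $u_0$ has finite second moment, $\Theta(u(t))=\int_{\mathbb{R}}x^2u(x,t)\,\mathrm{d}x$ is finite and absolutely continuous in $t\in[0,\infty)$. For a probability density $f$ on $\mathbb{R}$, the Rényi entropy of order $3/2$ is $\mathcal{R}_{3/2}(f)=-2\ln\left(\int_{\mathbb{R}}f^{3/2}\,\mathrm{d}x\right)$. If $B$ is a Barenblatt profile of unit mass with the same second moment as $f$, the relative Rényi entropy is $\mathcal{R}_{3/2}(f|B)=\mathcal{R}_{3/2}(B)-\mathcal{R}_{3/2}(f)\ge0$. Write $\Theta_t=\Theta(u(t))$. The profile is $$U_{3/2}(x,t)=\left(\frac{\Theta_t}{\Theta_0}\right)^{-1/2}\left(C_{3/2}-\frac13\,\frac{\Theta_0}{\Theta_t}\,\frac{x^2}{2\sigma_t}\right)_+^{2},$$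 where $(\cdot)_+=\max\{\cdot,0\}$ and $C_{3/2}>0$, $\sigma_t>0$ are determined by requiring that $U_{3/2}(\cdot,t)$ has unit mass and second moment equal to $\Theta_t$. *)

theory Defs
  imports "HOL-Analysis.Analysis"
begin

section \<open>Square-integrable functions, weak derivatives, Sobolev norms on the real line\<close>

text \<open>Lebesgue classes are represented by functions; all integrals are with respect to the
  completed measure, so changing a representative on a null set is harmless.\<close>

definition L2_on :: "'a::euclidean_space set \<Rightarrow> ('a \<Rightarrow> real) \<Rightarrow> bool" where
  "L2_on S f \<longleftrightarrow> f \<in> borel_measurable (lebesgue_on S) \<and> integrable (lebesgue_on S) (\<lambda>x. (f x)\<^sup>2)"

definition L2_norm :: "(real \<Rightarrow> real) \<Rightarrow> real" where
  "L2_norm f = sqrt (LINT x|lebesgue. (f x)\<^sup>2)"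

definition locally_integrable :: "(real \<Rightarrow> real) \<Rightarrow> bool" where
  "locally_integrable f \<longleftrightarrow> (\<forall>a b. integrable (lebesgue_on {a..b}) f)"

definition test_function :: "(real \<Rightarrow> real) \<Rightarrow> bool" where
  "test_function \<phi> \<longleftrightarrow>
     (\<forall>n x. ((deriv ^^ n) \<phi>) differentiable (at x)) \<and> compact (closure {x. \<phi> x \<noteq> 0})"

definition has_weak_deriv :: "nat \<Rightarrow> (real \<Rightarrow> real) \<Rightarrow> (real \<Rightarrow> real) \<Rightarrow> bool" where
  "has_weak_deriv j f g \<longleftrightarrow> locally_integrable f \<and> locally_integrable g \<and>
     (\<forall>\<phi>. test_function \<phi> \<longrightarrow>
        (LINT x|lebesgue. f x * (deriv ^^ j) \<phi> x) = (-1) ^ j * (LINT x|lebesgue. g x * \<phi> x))"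

text \<open>A representative of the weak derivative, which is unique up to null sets.\<close>

definition weak_deriv :: "nat \<Rightarrow> (real \<Rightarrow> real) \<Rightarrow> (real \<Rightarrow> real)" where
  "weak_deriv j f = (SOME g. has_weak_deriv j f g)"

definition sobolev :: "nat \<Rightarrow> (real \<Rightarrow> real) \<Rightarrow> bool" where
  "sobolev k f \<longleftrightarrow> (\<forall>j\<le>k. \<exists>g. has_weak_deriv j f g \<and> L2_on UNIV g)"

definition sobolev_norm :: "nat \<Rightarrow> (real \<Rightarrow> real) \<Rightarrow> real" where
  "sobolev_norm k f = sqrt (\<Sum>j\<le>k. (L2_norm (weak_deriv j f))\<^sup>2)"

section \<open>Bochner spaces with values in \<open>H\<^sup>k(\<real>)\<close>\<close>

text \<open>Strong measurability: almost everywhere limit, in the \<open>H\<^sup>k\<close> norm, of simple functions.\<close>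

definition strongly_measurable_sobolev ::
    "real set \<Rightarrow> nat \<Rightarrow> (real \<Rightarrow> real \<Rightarrow> real) \<Rightarrow> bool" where
  "strongly_measurable_sobolev I k f \<longleftrightarrow>
     (\<exists>s :: nat \<Rightarrow> real \<Rightarrow> real \<Rightarrow> real.
        (\<forall>n. simple_function (lebesgue_on I) (s n) \<and> (\<forall>t\<in>I. sobolev k (s n t))) \<and>
        (AE t in lebesgue_on I. sobolev k (f t) \<and>
           (\<lambda>n. sobolev_norm k (\<lambda>x. f t x - s n t x)) \<longlonglongrightarrow> 0))"

definition Linf_sobolev :: "real set \<Rightarrow> nat \<Rightarrow> (real \<Rightarrow> real \<Rightarrow> real) \<Rightarrow> bool" where
  "Linf_sobolev I k f \<longleftrightarrow> strongly_measurable_sobolev I k f \<and>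
     (\<exists>M. AE t in lebesgue_on I. sobolev_norm k (f t) \<le> M)"

definition L2_sobolev :: "real set \<Rightarrow> nat \<Rightarrow> (real \<Rightarrow> real \<Rightarrow> real) \<Rightarrow> bool" where
  "L2_sobolev I k f \<longleftrightarrow> strongly_measurable_sobolev I k f \<and>
     integrable (lebesgue_on I) (\<lambda>t. (sobolev_norm k (f t))\<^sup>2)"

section \<open>Functions of space and time\<close>

text \<open>A point of the plane is a pair \<open>(x, t)\<close>.\<close>

definition dx :: "(real \<times> real \<Rightarrow> real) \<Rightarrow> real \<times> real \<Rightarrow> real" where
  "dx f = (\<lambda>(x, t). deriv (\<lambda>y. f (y, t)) x)"

definition dt :: "(real \<times> real \<Rightarrow> real) \<Rightarrow> real \<times> real \<Rightarrow> real" where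
  "dt f = (\<lambda>(x, t). deriv (\<lambda>s. f (x, s)) t)"

primrec Ck_on :: "nat \<Rightarrow> (real \<times> real \<Rightarrow> real) \<Rightarrow> (real \<times> real) set \<Rightarrow> bool" where
  "Ck_on 0 f S \<longleftrightarrow> continuous_on S f"
| "Ck_on (Suc k) f S \<longleftrightarrow>
     (\<forall>(x, t)\<in>S. (\<lambda>y. f (y, t)) differentiable (at x) \<and> (\<lambda>s. f (x, s)) differentiable (at t)) \<and>
     Ck_on k (dx f) S \<and> Ck_on k (dt f) S"

definition smooth_on :: "(real \<times> real \<Rightarrow> real) \<Rightarrow> (real \<times> real) set \<Rightarrow> bool" where
  "smooth_on f S \<longleftrightarrow> (\<forall>k. Ck_on k f S)"

definition holder_on ::
    "real \<Rightarrow> real \<Rightarrow> (real \<times> real) set \<Rightarrow> (real \<times> real \<Rightarrow> real) \<Rightarrow> bool" where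
  "holder_on \<alpha> \<beta> S f \<longleftrightarrow> bounded (f ` S) \<and>
     (\<exists>L. \<forall>(x, t)\<in>S. \<forall>(y, s)\<in>S.
        \<bar>f (x, t) - f (y, s)\<bar> \<le> L * (\<bar>x - y\<bar> powr \<alpha> + \<bar>t - s\<bar> powr \<beta>))"

section \<open>Solutions of the thin-film equation\<close>

definition Q :: "(real \<times> real) set" where
  "Q = UNIV \<times> {0<..}"

definition P :: "(real \<times> real \<Rightarrow> real) \<Rightarrow> (real \<times> real) set" where
  "P u = Q - ({p. u p = 0} \<union> {p. snd p = 0})"

text \<open>A Lipschitz \<open>\<psi>\<close> is differentiable almost everywhere (Rademacher), so the arbitrary values
  of \<open>dx \<psi>\<close> and \<open>dt \<psi>\<close> elsewhere do not influence the integrals. Only the values of \<open>u\<close> on the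
  closure of \<open>Q\<close> matter.\<close>

definition weak_solution :: "(real \<times> real \<Rightarrow> real) \<Rightarrow> (real \<Rightarrow> real) \<Rightarrow> bool" where
  "weak_solution u u0 \<longleftrightarrow>
     (\<forall>p\<in>closure Q. 0 \<le> u p) \<and>
     holder_on (1/2) (1/8) (closure Q) u \<and>
     Linf_sobolev {0<..} 1 (\<lambda>t x. u (x, t)) \<and>
     smooth_on u (P u) \<and>
     L2_on (P u) (\<lambda>p. sqrt (u p) * (dx ^^ 3) u p) \<and>
     (\<forall>\<psi>. (\<exists>L. L-lipschitz_on UNIV \<psi>) \<and> compact (closure {p. \<psi> p \<noteq> 0}) \<and>
            closure {p. \<psi> p \<noteq> 0} \<subseteq> Q \<longrightarrow>
        (LINT p|lebesgue_on Q. u p * dt \<psi> p) +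
        (LINT p|lebesgue_on (P u). u p * (dx ^^ 3) u p * dx \<psi> p) = 0) \<and>
     (\<forall>x. u (x, 0) = u0 x) \<and>
     sobolev 1 u0 \<and> (\<forall>\<^sub>F t in at_right 0. sobolev 1 (\<lambda>x. u (x, t))) \<and>
     ((\<lambda>t. L2_norm (\<lambda>x. weak_deriv 1 (\<lambda>y. u (y, t)) x - weak_deriv 1 u0 x)) \<longlongrightarrow> 0) (at_right 0)"

definition strong_solution :: "(real \<times> real \<Rightarrow> real) \<Rightarrow> (real \<Rightarrow> real) \<Rightarrow> bool" where
  "strong_solution u u0 \<longleftrightarrow> weak_solution u u0 \<and>
     (\<forall>T>0. L2_sobolev {0<..<T} 2 (\<lambda>t x. u (x, t)))"

section \<open>Renyi entropy of order 3/2 and the Barenblatt profile\<close>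

text \<open>The conventions \<open>ln 0 = -\<infinity>\<close> and \<open>ln \<infinity> = \<infinity>\<close> are used.\<close>

definition renyi :: "(real \<Rightarrow> real) \<Rightarrow> ereal" where
  "renyi f = (let J = (\<integral>\<^sup>+x. ennreal (f x powr (3/2)) \<partial>lebesgue) in
     if J = 0 then \<infinity> else if J = \<infinity> then -\<infinity> else ereal (- 2 * ln (enn2real J)))"

definition relative_renyi :: "(real \<Rightarrow> real) \<Rightarrow> (real \<Rightarrow> real) \<Rightarrow> ereal" where
  "relative_renyi f B = renyi B - renyi f"

definition second_moment :: "(real \<Rightarrow> real) \<Rightarrow> real" where
  "second_moment f = (LINT x|lebesgue. x\<^sup>2 * f x)"

definition barenblatt :: "real \<Rightarrow> real \<Rightarrow> real \<Rightarrow> real \<Rightarrow> real \<Rightarrow> real" where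
  "barenblatt c \<sigma> \<theta>0 \<theta> x =
     (\<theta> / \<theta>0) powr (-1/2) * (max 0 (c - 1/3 * (\<theta>0 / \<theta>) * (x\<^sup>2 / (2 * \<sigma>))))\<^sup>2"

text \<open>The two moment conditions determine the pair \<open>(c, \<sigma>)\<close> uniquely for \<open>\<theta>0, \<theta> > 0\<close>; the
  resulting \<open>c\<close> turns out to depend on \<open>\<theta>0\<close> only.\<close>

definition barenblatt_params :: "real \<Rightarrow> real \<Rightarrow> real \<times> real" where
  "barenblatt_params \<theta>0 \<theta> = (THE p. case p of (c, \<sigma>) \<Rightarrow> c > 0 \<and> \<sigma> > 0 \<and>
     has_bochner_integral lebesgue (barenblatt c \<sigma> \<theta>0 \<theta>) 1 \<and>
     has_bochner_integral lebesgue (\<lambda>x. x\<^sup>2 * barenblatt c \<sigma> \<theta>0 \<theta> x) \<theta>)"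

definition barenblatt_profile :: "real \<Rightarrow> real \<Rightarrow> real \<Rightarrow> real" where
  "barenblatt_profile \<theta>0 \<theta> = (case barenblatt_params \<theta>0 \<theta> of (c, \<sigma>) \<Rightarrow> barenblatt c \<sigma> \<theta>0 \<theta>)"

definition U32 :: "(real \<times> real \<Rightarrow> real) \<Rightarrow> real \<Rightarrow> real \<Rightarrow> real" where
  "U32 u t = barenblatt_profile (second_moment (\<lambda>x. u (x, 0))) (second_moment (\<lambda>x. u (x, t)))"

end

(*
  Mass and second moment: testing the weak formulation with phi(x) eta(t), where
  phi'^2 <= kappa phi, AM-GM bounds the change of the integral of u phi over [0, b] by
  delta D / 2 + kappa b S / (2 delta), where D is the integral of u u_xxx^2 and S bounds the
  integral of u phi on [0, b]. For phi = (1 - x^2/r^2)_+^2 one has kappa = 16 / r^2, which yields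
  conservation of mass as r tends to infinity; for phi = x^2 (1 - x^2/r^2)_+^2 one has kappa = 16
  independently of r, which keeps the second moment finite.

  Entropy: the square root b of the Barenblatt profile B is the positive part of a quadratic q, and q
  integrates to the same value against B and against any density f with the same mass and second
  moment. Hence the gap between the integrals of f^(3/2) and B^(3/2) dominates the integral of
  (a - b)^2 (a + b/2), where a is the square root of f. This controls the L^1 distance, since
  f and B have equal mass and so only the part with f < B has to be estimated.
*)
theory Submission
  imports Defs
begin

section \<open>The bump function\<close>

text \<open>The same shape serves twice: rescaled, it is every Barenblatt profile of order 3/2, and
  it is the spatial cut-off for the weak formulation. The outer square makes it C^1 with a
  derivative controlled by its square root.\<close>

definition bump :: "real \<Rightarrow> real \<Rightarrow> real" where
  "bump r x = (max 0 (1 - (x / r)\<^sup>2))\<^sup>2"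

lemma bump_nonneg [simp]: "0 \<le> bump r x"
  by (simp add: bump_def)

lemma bump_le_1: "bump r x \<le> 1"
  unfolding bump_def by (rule power_le_one) auto

lemma continuous_on_bump [continuous_intros]: "continuous_on S (bump r)"
  unfolding bump_def divide_inverse by (intro continuous_intros)

lemma borel_measurable_bump [measurable]: "bump r \<in> borel_measurable borel"
  by (intro borel_measurable_continuous_onI continuous_intros)

lemma bump_eq_indicator:
  assumes "r > 0"
  shows "bump r x = (1 - (x / r)\<^sup>2)\<^sup>2 * indicator {- r..r} x"
proof -
  have "1 - (x / r)\<^sup>2 \<ge> 0 \<longleftrightarrow> x \<in> {- r..r}"
    using assms abs_le_square_iff[of "x / r" 1] by (auto simp: abs_le_iff field_simps)
  then show ?thesis
    by (auto simp: bump_def indicator_def max_def)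
qed

lemma bump_outside: "r > 0 \<Longrightarrow> x \<notin> {- r..r} \<Longrightarrow> bump r x = 0"
  by (simp add: bump_eq_indicator)

lemma has_bochner_integral_bump:
  assumes "r > 0"
  shows "has_bochner_integral lborel (bump r) (16 / 15 * r)"
proof -
  define F where "F x = x - 2 * x ^ 3 / (3 * r\<^sup>2) + x ^ 5 / (5 * r ^ 4)" for x
  have "has_bochner_integral lborel (\<lambda>x. (1 - (x / r)\<^sup>2)\<^sup>2 * indicator {- r..r} x) (F r - F (- r))"
  proof (rule has_bochner_integral_FTC_Icc_nonneg)
    show "(F has_real_derivative (1 - (x / r)\<^sup>2)\<^sup>2) (at x)" for x
      unfolding F_def using assms
      by (auto intro!: derivative_eq_intros simp: field_simps power2_eq_square power4_eq_xxxx)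
  qed (use assms in auto)
  moreover have "F r - F (- r) = 16 / 15 * r"
    using assms by (simp add: F_def field_simps eval_nat_numeral)
  ultimately show ?thesis
    using assms by (simp add: bump_eq_indicator fun_eq_iff cong: has_bochner_integral_cong)
qed

lemma has_bochner_integral_square_bump:
  assumes "r > 0"
  shows "has_bochner_integral lborel (\<lambda>x. x\<^sup>2 * bump r x) (16 / 105 * r ^ 3)"
proof -
  define F where "F x = x ^ 3 / 3 - 2 * x ^ 5 / (5 * r\<^sup>2) + x ^ 7 / (7 * r ^ 4)" for x
  have "has_bochner_integral lborel (\<lambda>x. (x\<^sup>2 * (1 - (x / r)\<^sup>2)\<^sup>2) * indicator {- r..r} x) (F r - F (- r))"
  proof (rule has_bochner_integral_FTC_Icc_nonneg)
    show "(F has_real_derivative x\<^sup>2 * (1 - (x / r)\<^sup>2)\<^sup>2) (at x)" for x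
      unfolding F_def using assms
      by (auto intro!: derivative_eq_intros simp: field_simps eval_nat_numeral)
  qed (use assms in auto)
  moreover have "F r - F (- r) = 16 / 105 * r ^ 3"
    using assms by (simp add: F_def field_simps eval_nat_numeral)
  ultimately show ?thesis
    using assms by (simp add: bump_eq_indicator fun_eq_iff mult.assoc cong: has_bochner_integral_cong)
qed

text \<open>Completing the measure does not change integrals of Borel functions. This moves the
  moment conditions, stated for the completed measure, to \<open>lborel\<close>, where the
  computations are done.\<close>

lemma has_bochner_integral_lebesgue:
  fixes f :: "'a::euclidean_space \<Rightarrow> real"
  assumes "f \<in> borel_measurable borel"
  shows "has_bochner_integral lebesgue f I \<longleftrightarrow> has_bochner_integral lborel f I"
  using assms by (simp add: has_bochner_integral_iff integrable_completion integral_completion)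

section \<open>Barenblatt profiles\<close>

text \<open>Pulling \<open>c\<close> out of the positive part leaves a bump whose radius is the zero
  of the quadratic, x^2 = 6 c \<sigma> \<theta> / \<theta>0.\<close>

lemma barenblatt_eq_bump:
  assumes "c > 0" "\<sigma> > 0" "\<theta>0 > 0" "\<theta> > 0"
  shows "barenblatt c \<sigma> \<theta>0 \<theta> x =
    (\<theta> / \<theta>0) powr (-1/2) * c\<^sup>2 * bump (sqrt (6 * c * \<sigma> * (\<theta> / \<theta>0))) x"
proof -
  define l where "l = \<theta> / \<theta>0"
  have l: "l > 0" "\<theta>0 / \<theta> = 1 / l" using assms by (auto simp: l_def)
  have "c - 1/3 * (1 / l) * (x\<^sup>2 / (2 * \<sigma>)) = c * (1 - (x / sqrt (6 * c * \<sigma> * l))\<^sup>2)"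
    using assms l by (simp add: power_divide field_simps)
  then have "max 0 (c - 1/3 * (1 / l) * (x\<^sup>2 / (2 * \<sigma>))) = c * max 0 (1 - (x / sqrt (6 * c * \<sigma> * l))\<^sup>2)"
    using assms by (auto simp: max_def mult_le_0_iff zero_le_mult_iff)
  then show ?thesis
    unfolding barenblatt_def bump_def l(2) l_def[symmetric]
    by (simp add: power_mult_distrib mult.assoc)
qed

text \<open>The quotient of second moment and mass of a bump is r^2/7, so the moment condition fixes
  the radius, hence \<sigma> in terms of \<open>c\<close>; the mass condition then fixes
  \<open>c\<close>. An equivalence is proved because the definite description in
  \<open>barenblatt_params\<close> needs uniqueness as well as existence.\<close>

lemma barenblatt_moments_iff:
  assumes pos: "c > 0" "\<sigma> > 0" "\<theta>0 > 0" "\<theta> > 0"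
  shows "has_bochner_integral lebesgue (barenblatt c \<sigma> \<theta>0 \<theta>) 1 \<and>
     has_bochner_integral lebesgue (\<lambda>x. x\<^sup>2 * barenblatt c \<sigma> \<theta>0 \<theta> x) \<theta> \<longleftrightarrow>
     c = sqrt (15 / (16 * sqrt (7 * \<theta>) * (\<theta> / \<theta>0) powr (-1/2))) \<and>
     \<sigma> = 7 * \<theta> / (6 * c * (\<theta> / \<theta>0))"
proof -
  define A where "A = (\<theta> / \<theta>0) powr (-1/2)"
  define r where "r = sqrt (6 * c * \<sigma> * (\<theta> / \<theta>0))"
  have A: "A > 0" and r: "r > 0" using pos by (auto simp: A_def r_def)
  have B: "barenblatt c \<sigma> \<theta>0 \<theta> = (\<lambda>x. A * c\<^sup>2 * bump r x)"
    using barenblatt_eq_bump[OF pos] by (auto simp: A_def r_def)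
  have m0: "has_bochner_integral lborel (barenblatt c \<sigma> \<theta>0 \<theta>) (A * c\<^sup>2 * (16/15 * r))"
    unfolding B by (intro has_bochner_integral_mult_right has_bochner_integral_bump r)
  have m2: "has_bochner_integral lborel (\<lambda>x. x\<^sup>2 * barenblatt c \<sigma> \<theta>0 \<theta> x) (A * c\<^sup>2 * (16/105 * r^3))"
    using has_bochner_integral_mult_right[OF has_bochner_integral_square_bump[OF r], of "A * c\<^sup>2"]
    unfolding B by (simp add: ac_simps)
  have [measurable]: "barenblatt c \<sigma> \<theta>0 \<theta> \<in> borel_measurable borel"
    unfolding B by measurable
  have "has_bochner_integral lborel f I \<Longrightarrow> has_bochner_integral lborel f J \<longleftrightarrow> J = I" for f :: "real \<Rightarrow> real" and I J
    by (auto simp: has_bochner_integral_iff)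
  note this[OF m0] this[OF m2]
  then have "has_bochner_integral lebesgue (barenblatt c \<sigma> \<theta>0 \<theta>) 1 \<and>
     has_bochner_integral lebesgue (\<lambda>x. x\<^sup>2 * barenblatt c \<sigma> \<theta>0 \<theta> x) \<theta> \<longleftrightarrow>
     1 = A * c\<^sup>2 * (16/15 * r) \<and> \<theta> = A * c\<^sup>2 * (16/105 * r^3)"
    by (simp add: has_bochner_integral_lebesgue)
  also have "\<dots> \<longleftrightarrow> c\<^sup>2 = 15 / (16 * sqrt (7 * \<theta>) * A) \<and> r\<^sup>2 = 7 * \<theta>"
  proof (intro iffI conjI; elim conjE)
    assume 1: "1 = A * c\<^sup>2 * (16/15 * r)" and 2: "\<theta> = A * c\<^sup>2 * (16/105 * r^3)"
    have "\<theta> = A * c\<^sup>2 * (16/15 * r) * r\<^sup>2 / 7" using 2 by (simp add: eval_nat_numeral)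
    then show *: "r\<^sup>2 = 7 * \<theta>" unfolding 1[symmetric] by simp
    have "sqrt (7 * \<theta>) = r" unfolding *[symmetric] using r by simp
    with 1 A r show "c\<^sup>2 = 15 / (16 * sqrt (7 * \<theta>) * A)" by (simp add: field_simps)
  next
    assume 1: "c\<^sup>2 = 15 / (16 * sqrt (7 * \<theta>) * A)" and 2: "r\<^sup>2 = 7 * \<theta>"
    have *: "sqrt (7 * \<theta>) = r" unfolding 2[symmetric] using r by simp
    show "1 = A * c\<^sup>2 * (16/15 * r)" using 1 A r * by (simp add: field_simps)
    then have "A * c\<^sup>2 * (16/105 * r^3) = r\<^sup>2 / 7"
      by (simp add: eval_nat_numeral field_simps)
    then show "\<theta> = A * c\<^sup>2 * (16/105 * r^3)" using 2 by simp
  qed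
  also have "r\<^sup>2 = 7 * \<theta> \<longleftrightarrow> \<sigma> = 7 * \<theta> / (6 * c * (\<theta> / \<theta>0))"
    using pos by (simp add: r_def field_simps)
  also have "c\<^sup>2 = 15 / (16 * sqrt (7 * \<theta>) * A) \<longleftrightarrow> c = sqrt (15 / (16 * sqrt (7 * \<theta>) * A))"
    using pos A by (smt (verit) real_sqrt_pow2 real_sqrt_unique divide_nonneg_nonneg mult_nonneg_nonneg real_sqrt_ge_zero)
  finally show ?thesis by (simp add: A_def)
qed

text \<open>Replaces the definite description by a scaled bump. The relation
  \<open>A * r = 15 / 16\<close> is the mass normalisation; it is the only quantitative information
  that later enters the constant, which is therefore free of \<theta>0 and \<theta>.\<close>

lemma barenblatt_profile_eq:
  assumes "\<theta>0 > 0" "\<theta> > 0"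
  obtains A r where "A > 0" "r > 0" "A * r = 15 / 16"
    "barenblatt_profile \<theta>0 \<theta> = (\<lambda>x. A * bump r x)"
    "has_bochner_integral lborel (\<lambda>x. A * bump r x) 1"
    "has_bochner_integral lborel (\<lambda>x. x\<^sup>2 * (A * bump r x)) \<theta>"
proof -
  define c where "c = sqrt (15 / (16 * sqrt (7 * \<theta>) * (\<theta> / \<theta>0) powr (-1/2)))"
  define \<sigma> where "\<sigma> = 7 * \<theta> / (6 * c * (\<theta> / \<theta>0))"
  have pos: "c > 0" "\<sigma> > 0"
    using assms by (auto simp: c_def \<sigma>_def)
  have "barenblatt_params \<theta>0 \<theta> = (c, \<sigma>)"
    unfolding barenblatt_params_def
  proof (rule the_equality, goal_cases)
    case 1
    show ?case
      using barenblatt_moments_iff[of c \<sigma> \<theta>0 \<theta>] pos assms by (auto simp: c_def \<sigma>_def)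
  next
    case (2 p)
    then show ?case
      using barenblatt_moments_iff[of "fst p" "snd p" \<theta>0 \<theta>] assms
      by (auto simp: c_def \<sigma>_def split: prod.splits)
  qed
  then have prof: "barenblatt_profile \<theta>0 \<theta> = barenblatt c \<sigma> \<theta>0 \<theta>"
    by (simp add: barenblatt_profile_def)
  define A where "A = (\<theta> / \<theta>0) powr (-1/2) * c\<^sup>2"
  define r where "r = sqrt (6 * c * \<sigma> * (\<theta> / \<theta>0))"
  have A: "A > 0" and r: "r > 0" using pos assms by (auto simp: A_def r_def)
  have B: "barenblatt c \<sigma> \<theta>0 \<theta> = (\<lambda>x. A * bump r x)"
    using barenblatt_eq_bump[OF pos assms] by (auto simp: A_def r_def)
  have "has_bochner_integral lebesgue (\<lambda>x. A * bump r x) 1"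
    "has_bochner_integral lebesgue (\<lambda>x. x\<^sup>2 * (A * bump r x)) \<theta>"
    using barenblatt_moments_iff[OF pos assms] unfolding B by (auto simp: c_def \<sigma>_def)
  then have m: "has_bochner_integral lborel (\<lambda>x. A * bump r x) 1"
    "has_bochner_integral lborel (\<lambda>x. x\<^sup>2 * (A * bump r x)) \<theta>"
    by (simp_all add: has_bochner_integral_lebesgue)
  have "A * (16 / 15 * r) = 1"
    by (rule has_bochner_integral_eq[OF _ m(1)])
      (intro has_bochner_integral_mult_right has_bochner_integral_bump r)
  then have "A * r = 15 / 16" by simp
  with that A r prof B m show thesis by simp
qed

section \<open>A Csiszar-Kullback inequality for the Renyi entropy\<close>

lemma four_mult_le_square_add: "4 * p * q \<le> (p + q)\<^sup>2" for p q :: real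
  using zero_le_power2[of "p - q"] by (simp add: power2_eq_square algebra_simps)

text \<open>The gap is measured relative to \<open>JB\<close> to make the estimate scale invariant:
  the bounds 2 r A^(3/2) for \<open>JB\<close> and 2 r A^(1/2) for the integral of sqrt B combine
  into a multiple of \<open>A * r\<close>, a fixed number.\<close>

lemma renyi_integral_gap:
  fixes f :: "real \<Rightarrow> real" and A r :: real
  defines "B \<equiv> \<lambda>x. A * bump r x"
  assumes A: "A > 0" and r: "r > 0" and Ar: "A * r = 15 / 16"
  assumes [measurable]: "f \<in> borel_measurable borel" and f0: "\<And>x. 0 \<le> f x"
  assumes f1: "has_bochner_integral lborel f 1" and B1: "has_bochner_integral lborel B 1"
  assumes f2: "has_bochner_integral lborel (\<lambda>x. x\<^sup>2 * f x) \<theta>"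
    and B2: "has_bochner_integral lborel (\<lambda>x. x\<^sup>2 * B x) \<theta>"
  assumes fJ: "has_bochner_integral lborel (\<lambda>x. f x powr (3/2)) Jf"
  obtains JB where "has_bochner_integral lborel (\<lambda>x. B x powr (3/2)) JB" "JB > 0" "Jf \<ge> JB"
    "(LINT x|lborel. \<bar>f x - B x\<bar>) \<le> 15 / 2 * sqrt (Jf / JB - 1)"
proof -
  have [measurable]: "B \<in> borel_measurable borel" unfolding B_def by measurable
  have B0: "0 \<le> B x" for x using A by (simp add: B_def)
  \<comment> \<open>Only crude bounds by rectangles of width 2 r are used for B, sqrt B and
    B^(3/2).\<close>
  have BA: "B x \<le> A * indicator {- r..r} x" for x
    using A bump_le_1[of r x] bump_outside[OF r, of x] by (auto simp: B_def indicator_def)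
  have ind: "has_bochner_integral lborel (\<lambda>x. c * indicator {- r..r} x) (c * (2 * r))" for c :: real
    using has_bochner_integral_mult_right[OF has_bochner_integral_real_indicator[of "{- r..r}" lborel], of c] r
    by simp
  define b where "b x = sqrt (B x)" for x
  have [measurable]: "b \<in> borel_measurable borel" unfolding b_def by measurable
  have b0: "0 \<le> b x" for x by (simp add: b_def B0)
  have bA: "b x \<le> sqrt A * indicator {- r..r} x" for x
    using BA[of x] real_sqrt_le_mono[OF BA[of x]] by (auto simp: b_def indicator_def split: if_splits)
  have p32: "y powr (3/2) = sqrt y ^ 3" if "y \<ge> 0" for y :: real
    using that by (simp add: powr_half_sqrt[symmetric] powr_powr flip: powr_numeral)
  have BJle: "B x powr (3/2) \<le> A * sqrt A * indicator {- r..r} x" for x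
  proof -
    have "b x ^ 3 \<le> (sqrt A * indicator {- r..r} x) ^ 3"
      by (intro power_mono bA b0)
    also have "\<dots> = A * sqrt A * indicator {- r..r} x"
      using A by (auto simp: indicator_def eval_nat_numeral)
    finally show ?thesis using p32[OF B0[of x]] by (simp add: b_def)
  qed
  have BJi: "integrable lborel (\<lambda>x. B x powr (3/2))"
    by (rule Bochner_Integration.integrable_bound[of _ "\<lambda>x. A * sqrt A * indicator {- r..r} x"])
      (use ind BJle A in \<open>auto simp: has_bochner_integral_iff intro!: AE_I2\<close>)
  have bi: "integrable lborel b"
    by (rule Bochner_Integration.integrable_bound[of _ "\<lambda>x. sqrt A * indicator {- r..r} x"])
      (use ind bA b0 A in \<open>auto simp: has_bochner_integral_iff intro!: AE_I2\<close>)
  define JB where "JB = (LINT x|lborel. B x powr (3/2))"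
  have JBle: "JB \<le> A * sqrt A * (2 * r)"
    using integral_mono[OF BJi _ BJle] ind[of "A * sqrt A"] r
    by (simp add: has_bochner_integral_iff JB_def)
  have ible: "(LINT x|lborel. b x) \<le> sqrt A * (2 * r)"
    using integral_mono[OF bi _ bA] ind[of "sqrt A"] r
    by (simp add: has_bochner_integral_iff)
  have JBpos: "JB > 0"
  proof -
    have "JB \<noteq> 0"
    proof
      assume "JB = 0"
      then have "AE x in lborel. B x powr (3/2) = 0"
        using integral_nonneg_eq_0_iff_AE[OF BJi] by (auto simp: JB_def)
      then have "AE x in lborel. B x = 0" by auto
      then have "(LINT x|lborel. B x) = 0" by (rule integral_eq_zero_AE)
      with B1 show False by (simp add: has_bochner_integral_iff)
    qed
    moreover have "JB \<ge> 0" unfolding JB_def by simp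
    ultimately show ?thesis by simp
  qed

  \<comment> \<open>Unlike its positive part \<open>b\<close>, the quadratic \<open>q\<close> is a
    combination of 1 and x^2, so its integral against f - B vanishes by equality of mass and second
    moment.\<close>
  define q where "q x = sqrt A * (1 - (x / r)\<^sup>2)" for x
  have b_eq: "b x = max 0 (q x)" for x
    using A by (auto simp: b_def B_def bump_def real_sqrt_mult q_def max_def mult_le_0_iff zero_le_mult_iff)
  \<comment> \<open>With a = sqrt f, \<open>br\<close> equals a^3 - b^3 - 3/2 b (a^2 - b^2), the
    Bregman divergence of s^(3/2) between f and B. In \<open>D\<close> the slope \<open>b\<close> is
    replaced by \<open>q\<close>, which makes the integral of \<open>D\<close> equal to
    \<open>Jf - JB\<close>.\<close>
  define D where "D x = f x powr (3/2) - B x powr (3/2) - 3/2 * (q x * (f x - B x))" for x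
  define br where "br x = (sqrt (f x) - b x)\<^sup>2 * (sqrt (f x) + b x / 2)" for x
  have br0: "0 \<le> br x" for x using f0 b0 by (simp add: br_def)
  have br_le_D: "br x \<le> D x" for x
  proof -
    define a where "a = sqrt (f x)"
    have fa: "f x = a\<^sup>2" and Bb: "B x = (b x)\<^sup>2" using f0 B0 by (simp_all add: a_def b_def)
    have "f x powr (3/2) = a ^ 3" "B x powr (3/2) = b x ^ 3"
      using p32[OF f0[of x]] p32[OF B0[of x]] by (simp_all add: a_def b_def)
    moreover have "0 \<le> a" by (simp add: a_def f0)
    ultimately have "D x - br x = 3/2 * ((b x - q x) * (a\<^sup>2 - (b x)\<^sup>2))"
      unfolding D_def br_def a_def[symmetric] fa Bb by (simp add: algebra_simps eval_nat_numeral) 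
    \<comment> \<open>Either \<open>q\<close> equals \<open>b\<close>, or \<open>q\<close> is
      negative and \<open>b\<close> is 0, which leaves -q a^2.\<close>
    also have "\<dots> \<ge> 0"
      by (cases "q x \<ge> 0") (auto simp: b_eq max_def mult_le_0_iff)
    finally show ?thesis by simp
  qed
  have D0: "0 \<le> D x" for x using br0 br_le_D order_trans by blast
  have q_eq: "q x * (f x - B x) = sqrt A * (f x - B x) - sqrt A / r\<^sup>2 * (x\<^sup>2 * f x - x\<^sup>2 * B x)" for x
    by (simp add: q_def power_divide algebra_simps diff_divide_distrib)
  have "has_bochner_integral lborel (\<lambda>x. sqrt A * (f x - B x) - sqrt A / r\<^sup>2 * (x\<^sup>2 * f x - x\<^sup>2 * B x))
     (sqrt A * (1 - 1) - sqrt A / r\<^sup>2 * (\<theta> - \<theta>))"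
    by (intro has_bochner_integral_diff has_bochner_integral_mult_right f1 f2 B1 B2)
  then have qi: "has_bochner_integral lborel (\<lambda>x. q x * (f x - B x)) 0"
    by (simp add: q_eq)
  have BJ: "has_bochner_integral lborel (\<lambda>x. B x powr (3/2)) JB"
    using BJi by (simp add: JB_def has_bochner_integral_iff)
  have Di: "has_bochner_integral lborel D (Jf - JB - 3/2 * 0)"
    unfolding D_def by (intro has_bochner_integral_diff has_bochner_integral_mult_right fJ BJ qi)
  have Jge: "Jf \<ge> JB"
  proof -
    have "0 \<le> (LINT x|lborel. D x)"
      by (rule Bochner_Integration.integral_nonneg) (rule D0)
    then show ?thesis using Di by (simp add: has_bochner_integral_iff)
  qed
  \<comment> \<open>Since |f - B| is (f - B) plus twice the positive part of B - f and f - B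
    integrates to 0, only points with f < B need an estimate. The free parameter \<open>e\<close> is
    the weight in AM-GM.\<close>
  have key: "\<bar>f x - B x\<bar> \<le> (f x - B x) + 2 * (e * b x + D x / e)" if e: "e > 0" for e x
  proof (cases "f x \<ge> B x")
    case True
    then show ?thesis using e D0[of x] b0[of x] by simp
  next
    case False
    define a where "a = sqrt (f x)"
    have fa: "f x = a\<^sup>2" and Bb: "B x = (b x)\<^sup>2" using f0 B0 by (simp_all add: a_def b_def)
    have a0: "0 \<le> a" by (simp add: a_def f0)
    have ab: "a \<le> b x" using False by (simp add: a_def b_def)
    \<comment> \<open>Of the factorisation B - f = (b - a)(b + a), the square of the first factor
      belongs to \<open>br\<close>. The square of the second is at most 4 b (a + b/2) because a <= b
      here, and AM-GM then separates \<open>b\<close> from \<open>br\<close>.\<close>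
    have "(B x - f x)\<^sup>2 = (a - b x)\<^sup>2 * (a + b x)\<^sup>2"
      unfolding fa Bb by (simp add: power2_eq_square algebra_simps)
    also have "\<dots> \<le> (a - b x)\<^sup>2 * (4 * b x * (a + b x / 2))"
    proof (rule mult_left_mono)
      have "(a + b x)\<^sup>2 \<le> (2 * b x) * (a + b x)"
        unfolding power2_eq_square using ab a0 b0[of x] by (intro mult_right_mono) auto
      also have "\<dots> \<le> 4 * b x * (a + b x / 2)"
        using a0 b0[of x] by (simp add: algebra_simps)
      finally show "(a + b x)\<^sup>2 \<le> 4 * b x * (a + b x / 2)" .
    qed simp
    also have "\<dots> = 4 * (e * b x) * (br x / e)"
      using e by (simp add: br_def a_def)
    also have "\<dots> \<le> (e * b x + br x / e)\<^sup>2"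
      by (rule four_mult_le_square_add)
    finally have "B x - f x \<le> e * b x + br x / e"
      by (rule power2_le_imp_le) (use e b0[of x] br0[of x] in simp)
    moreover have "br x / e \<le> D x / e" using e br_le_D by (simp add: divide_right_mono)
    ultimately show ?thesis using False by simp
  qed
  define N where "N = (LINT x|lborel. \<bar>f x - B x\<bar>)"
  define y where "y = Jf / JB - 1"
  have y0: "y \<ge> 0" using Jge JBpos by (simp add: y_def field_simps)
  have N_le: "N \<le> 15 / 4 * (e + y / e)" if e: "e > 0" for e
  proof -
    \<comment> \<open>This rescaling lets both terms carry the same factor, so that the sum becomes
      4 A r (e + y/e).\<close>
    define e' where "e' = e * sqrt A"
    have e': "e' > 0" using e A by (simp add: e'_def)
    have M: "has_bochner_integral lborel (\<lambda>x. (f x - B x) + 2 * (e' * b x + D x / e'))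
       ((1 - 1) + 2 * (e' * (LINT x|lborel. b x) + (Jf - JB - 3/2 * 0) / e'))"
      by (intro has_bochner_integral_add has_bochner_integral_diff has_bochner_integral_mult_right
          has_bochner_integral_divide f1 B1 Di has_bochner_integral_integrable bi)
    have "integrable lborel (\<lambda>x. \<bar>f x - B x\<bar>)"
      using f1 B1 by (simp add: has_bochner_integral_iff)
    then have "N \<le> (LINT x|lborel. (f x - B x) + 2 * (e' * b x + D x / e'))"
      unfolding N_def by (rule integral_mono) (use M key[OF e'] in \<open>simp_all only: has_bochner_integral_iff\<close>)
    also have "\<dots> = (1 - 1) + 2 * (e' * (LINT x|lborel. b x) + (Jf - JB - 3/2 * 0) / e')"
      by (rule has_bochner_integral_integral_eq[OF M])
    also have "\<dots> = 2 * (e' * (LINT x|lborel. b x) + JB * y / e')"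
      using JBpos by (simp add: y_def algebra_simps)
    also have "\<dots> \<le> 2 * (e' * (sqrt A * (2 * r)) + (A * sqrt A * (2 * r)) * y / e')"
      using e' y0 ible JBle by (intro mult_left_mono add_mono divide_right_mono mult_right_mono) auto
    also have "\<dots> = 4 * (A * r) * (e + y / e)"
      using A e by (simp add: e'_def field_simps)
    finally show ?thesis unfolding Ar by simp
  qed
  have "N \<le> 15 / 2 * sqrt y"
  \<comment> \<open>The optimal weight is e = sqrt y. For y = 0 it is not positive, and arbitrarily
    small weights are used instead.\<close>
  proof (cases "y = 0")
    case True
    have "N \<le> 0"
    proof (rule field_le_epsilon)
      fix e :: real assume "e > 0"
      then show "N \<le> 0 + e" using N_le[of "4 / 15 * e"] True by simp
    qed
    with True show ?thesis by simp
  next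
    case False
    then show ?thesis using N_le[of "sqrt y"] y0 by (simp add: real_div_sqrt)
  qed
  then show thesis using that BJ JBpos Jge unfolding N_def y_def by blast
qed

text \<open>Passes from y - 1 to the logarithm by ln y >= (y - 1)/y. For y <= 2 this gives y - 1 <=
  2 ln y; for larger y it gives 2 ln y >= 1, and the trivial bound N <= 2 is enough.\<close>

lemma le_sqrt_two_ln:
  fixes N y :: real
  assumes "N \<le> 2" "N \<le> 15 / 2 * sqrt (y - 1)" "y \<ge> 1"
  shows "N \<le> 15 / 2 * sqrt (2 * ln y)"
proof -
  have "ln (1 / y) \<le> 1 / y - 1" using assms by (intro ln_le_minus_one) auto
  then have ln: "ln y \<ge> (y - 1) / y" using assms by (simp add: ln_div field_simps)
  show ?thesis
  proof (cases "y \<le> 2")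
    case True
    have "(y - 1) / 2 \<le> (y - 1) / y" using assms True by (intro divide_left_mono) auto
    from order_trans[OF this ln] have "y - 1 \<le> 2 * ln y" by simp
    then have "sqrt (y - 1) \<le> sqrt (2 * ln y)" by (rule real_sqrt_le_mono)
    with assms(2) show ?thesis by linarith
  next
    case False
    then have "(y - 1) / y \<ge> 1 / 2" by (simp add: field_simps)
    from order_trans[OF this ln] have "1 \<le> sqrt (2 * ln y)" by simp
    with assms(1) show ?thesis by linarith
  qed
qed

section \<open>Cut-off functions\<close>

text \<open>At the kink the difference quotient is dominated by |h|. All cut-offs are built from
  this C^1 function and so have classical derivatives everywhere.\<close>

lemma DERIV_square_max_0:
  "((\<lambda>s::real. (max 0 s)\<^sup>2) has_real_derivative 2 * max 0 x) (at x)"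
proof (cases x "0 :: real" rule: linorder_cases)
  case less
  have "((\<lambda>s::real. 0) has_real_derivative 2 * max 0 x) (at x)"
    using less by simp
  then show ?thesis
    by (rule has_field_derivative_transform_within_open[of _ _ _ "{..<0}"]) (use less in auto)
next
  case greater
  have "((\<lambda>s::real. s\<^sup>2) has_real_derivative 2 * max 0 x) (at x)"
    using greater by (auto intro!: derivative_eq_intros)
  then show ?thesis
    by (rule has_field_derivative_transform_within_open[of _ _ _ "{0<..}"]) (use greater in auto)
next
  case equal
  have "((\<lambda>h::real. (max 0 h)\<^sup>2 / h) \<longlongrightarrow> 0) (at 0)"
  proof (rule Lim_null_comparison)
    show "\<forall>\<^sub>F h in at 0. norm ((max 0 h)\<^sup>2 / h) \<le> \<bar>h::real\<bar>"
      by (rule always_eventually) (auto simp: max_def power2_eq_square)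
    show "((\<lambda>h::real. \<bar>h\<bar>) \<longlongrightarrow> 0) (at 0)"
      by (auto intro!: tendsto_eq_intros)
  qed
  with equal show ?thesis by (simp add: DERIV_def)
qed

lemma DERIV_bump:
  assumes "r > 0"
  shows "(bump r has_real_derivative 2 * max 0 (1 - (x / r)\<^sup>2) * (- 2 * x / r\<^sup>2)) (at x)"
proof -
  have "((\<lambda>x. 1 - (x / r)\<^sup>2) has_real_derivative - 2 * x / r\<^sup>2) (at x)"
    using assms by (auto intro!: derivative_eq_intros simp: power2_eq_square)
  from DERIV_chain2[OF DERIV_square_max_0 this] show ?thesis
    unfolding bump_def[abs_def] .
qed

lemma DERIV_square_bump:
  assumes "r > 0"
  shows "((\<lambda>x. x\<^sup>2 * bump r x) has_real_derivative
    2 * x * max 0 (1 - (x / r)\<^sup>2) * (max 0 (1 - (x / r)\<^sup>2) - 2 * (x / r)\<^sup>2)) (at x)"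
proof -
  define m where "m = max 0 (1 - (x / r)\<^sup>2)"
  have b: "bump r x = m\<^sup>2" by (simp add: bump_def m_def)
  have sq: "((\<lambda>x. x\<^sup>2) has_real_derivative 2 * x) (at x)"
    by (auto intro!: derivative_eq_intros)
  show ?thesis
    unfolding m_def[symmetric]
    by (rule DERIV_cong[OF DERIV_mult[OF sq DERIV_bump[OF assms, of x, folded m_def]]])
      (simp add: b power2_eq_square algebra_simps)
qed

text \<open>The tent on the interval [0, 2] with peak 1 and area 1, written as a second difference
  of positive parts so that it has a termwise antiderivative.\<close>

definition hat :: "real \<Rightarrow> real" where
  "hat s = max 0 s - 2 * max 0 (s - 1) + max 0 (s - 2)"

text \<open>A \<open>C\<^sup>1\<close> step, so that the derivative of the time cut-off has no exceptional null set.\<close>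

definition smooth_step :: "real \<Rightarrow> real" where
  "smooth_step s = ((max 0 s)\<^sup>2 - 2 * (max 0 (s - 1))\<^sup>2 + (max 0 (s - 2))\<^sup>2) / 2"

lemma DERIV_smooth_step: "(smooth_step has_real_derivative hat x) (at x)"
proof -
  have "((\<lambda>s. (max 0 (s - c))\<^sup>2) has_real_derivative 2 * max 0 (x - c) * 1) (at x)" for c
    by (rule DERIV_chain2[OF DERIV_square_max_0]) (auto intro!: derivative_eq_intros)
  note D = this[of 0] this[of 1] this[of 2]
  show ?thesis
    unfolding smooth_step_def[abs_def] hat_def
    by (rule DERIV_cong[OF DERIV_cdivide[OF DERIV_add[OF DERIV_diff[OF D(1)[simplified] DERIV_cmult[OF D(2)]] D(3)]]])
      simp
qed

lemma hat_nonneg: "0 \<le> hat s"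
  by (simp add: hat_def max_def)

lemma hat_eq_0: "s \<le> 0 \<or> s \<ge> 2 \<Longrightarrow> hat s = 0"
  by (auto simp: hat_def max_def)

lemma continuous_on_hat [continuous_intros]: "continuous_on S hat"
  unfolding hat_def by (intro continuous_intros)

lemma smooth_step_eq_0: "s \<le> 0 \<Longrightarrow> smooth_step s = 0"
  by (auto simp: smooth_step_def max_def)

lemma smooth_step_eq_1: "s \<ge> 2 \<Longrightarrow> smooth_step s = 1"
  by (auto simp: smooth_step_def max_def power2_eq_square algebra_simps)

lemma smooth_step_mono: "x \<le> y \<Longrightarrow> smooth_step x \<le> smooth_step y"
  by (rule DERIV_nonneg_imp_nondecreasing[of x y smooth_step])
    (use DERIV_smooth_step hat_nonneg in blast)+

lemma smooth_step_nonneg: "0 \<le> smooth_step s"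
  using smooth_step_mono[of "min 0 s" s] smooth_step_eq_0[of "min 0 s"] by simp

lemma smooth_step_le_1: "smooth_step s \<le> 1"
  using smooth_step_mono[of s "max 2 s"] smooth_step_eq_1[of "max 2 s"] by simp

lemma continuous_on_smooth_step [continuous_intros]: "continuous_on S smooth_step"
  using DERIV_smooth_step by (meson DERIV_continuous_on has_field_derivative_at_within)

lemma DERIV_smooth_step_scaled:
  assumes "h > 0"
  shows "((\<lambda>t. smooth_step ((t - c) / h)) has_real_derivative hat ((t - c) / h) / h) (at t)"
proof -
  have "((\<lambda>t. (t - c) / h) has_real_derivative 1 / h) (at t)"
    using assms by (auto intro!: derivative_eq_intros)
  from DERIV_chain2[OF DERIV_smooth_step this] show ?thesis by simp
qed

section \<open>Averages in time and bounds for compactly supported functions\<close>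

lemma integrable_compact_support:
  fixes f :: "'a::euclidean_space \<Rightarrow> real"
  assumes "continuous_on UNIV f" "compact S" "\<And>x. x \<notin> S \<Longrightarrow> f x = 0"
  shows "integrable lborel f"
proof -
  have "integrable lborel (\<lambda>x. indicator S x *\<^sub>R f x)"
    using assms by (intro borel_integrable_compact) (auto intro: continuous_on_subset)
  moreover have "(\<lambda>x. indicator S x *\<^sub>R f x) = f"
    using assms(3) by (auto simp: indicator_def fun_eq_iff)
  ultimately show ?thesis by simp
qed

lemma integrable_mult_hat:
  fixes g :: "real \<Rightarrow> real"
  assumes h: "h > 0" and g: "continuous_on UNIV g"
  shows "integrable lborel (\<lambda>t. g t * (hat ((t - c) / h) / h))"
proof (rule integrable_compact_support[of _ "{c..c + 2 * h}"])
  show "continuous_on UNIV (\<lambda>t. g t * (hat ((t - c) / h) / h))"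
    using h g by (auto intro!: continuous_intros continuous_on_compose2[OF continuous_on_hat[of UNIV]])
  show "g t * (hat ((t - c) / h) / h) = 0" if "t \<notin> {c..c + 2 * h}" for t
    using that h by (auto simp: field_simps intro!: hat_eq_0)
qed simp

text \<open>The weight is a probability density on \<open>{c..c + 2 * h}\<close>, its mass being the
  rise of \<open>smooth_step\<close> from 0 to 1. Integrating against the derivative of a time
  cut-off thus recovers nearby point values of \<open>g\<close>.\<close>

lemma hat_average:
  fixes g :: "real \<Rightarrow> real"
  assumes h: "h > 0" and g: "continuous_on UNIV g"
    and near: "\<And>t. t \<in> {c..c + 2 * h} \<Longrightarrow> \<bar>g t - m\<bar> \<le> \<epsilon>"
  shows "\<bar>(LINT t|lborel. g t * (hat ((t - c) / h) / h)) - m\<bar> \<le> \<epsilon>"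
proof -
  define \<rho> where "\<rho> t = hat ((t - c) / h) / h" for t
  have \<rho>0: "\<rho> t \<ge> 0" for t using h by (simp add: \<rho>_def hat_nonneg)
  have \<rho>out: "\<rho> t = 0" if "t \<notin> {c..c + 2 * h}" for t
    using that h by (auto simp: \<rho>_def field_simps intro!: hat_eq_0)
  have c\<rho>: "continuous_on UNIV \<rho>"
    unfolding \<rho>_def using h
    by (auto intro!: continuous_intros continuous_on_compose2[OF continuous_on_hat[of UNIV]])
  have "has_bochner_integral lborel (\<lambda>t. \<rho> t * indicator {c..c + 2 * h} t)
     (smooth_step ((c + 2 * h - c) / h) - smooth_step ((c - c) / h))"
  proof (rule has_bochner_integral_FTC_Icc_nonneg[where F = "\<lambda>t. smooth_step ((t - c) / h)"])
    show "\<rho> \<in> borel_measurable borel" by (rule borel_measurable_continuous_onI[OF c\<rho>])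
    show "((\<lambda>t. smooth_step ((t - c) / h)) has_real_derivative \<rho> t) (at t)" for t
      unfolding \<rho>_def by (rule DERIV_smooth_step_scaled[OF h])
  qed (use h \<rho>0 in auto)
  moreover have "(\<lambda>t. \<rho> t * indicator {c..c + 2 * h} t) = \<rho>"
    using \<rho>out by (auto simp: indicator_def fun_eq_iff)
  ultimately have one: "has_bochner_integral lborel \<rho> 1"
    using h by (simp add: smooth_step_eq_0 smooth_step_eq_1)
  have gi': "integrable lborel (\<lambda>t. g t * \<rho> t)"
    using integrable_mult_hat[OF h g] by (simp add: \<rho>_def)
  have "(LINT t|lborel. g t * \<rho> t) - m = (LINT t|lborel. g t * \<rho> t - m * \<rho> t)"
    using gi' one by (simp add: has_bochner_integral_iff)
  also have "\<bar>\<dots>\<bar> \<le> (LINT t|lborel. \<epsilon> * \<rho> t)"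
  proof (rule integral_abs_bound_integral)
    show "integrable lborel (\<lambda>t. g t * \<rho> t - m * \<rho> t)" "integrable lborel (\<lambda>t. \<epsilon> * \<rho> t)"
      using gi' one by (simp_all add: has_bochner_integral_iff)
    show "\<bar>g t * \<rho> t - m * \<rho> t\<bar> \<le> \<epsilon> * \<rho> t" for t
    proof (cases "t \<in> {c..c + 2 * h}")
      case True
      have "\<bar>g t * \<rho> t - m * \<rho> t\<bar> = \<bar>g t - m\<bar> * \<rho> t"
        using \<rho>0[of t] by (simp add: left_diff_distrib[symmetric] abs_mult)
      also have "\<dots> \<le> \<epsilon> * \<rho> t" using near[OF True] \<rho>0 by (intro mult_right_mono)
      finally show ?thesis .
    qed (simp add: \<rho>out)
  qed
  also have "\<dots> = \<epsilon>" using one by (simp add: has_bochner_integral_iff)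
  finally show "\<bar>(LINT t|lborel. g t * (hat ((t - c) / h) / h)) - m\<bar> \<le> \<epsilon>"
    by (simp add: \<rho>_def)
qed

lemma C1_compact_support_lipschitz:
  fixes f f' :: "real \<Rightarrow> real"
  assumes "\<And>x. (f has_real_derivative f' x) (at x)" "continuous_on UNIV f'"
    and "\<And>x. x \<notin> {a..b} \<Longrightarrow> f' x = 0"
  obtains L where "L \<ge> 0" "\<And>x y. \<bar>f x - f y\<bar> \<le> L * \<bar>x - y\<bar>"
proof -
  have "bounded (f' ` {a..b})"
    using assms(2) by (intro compact_imp_bounded compact_continuous_image)
      (auto intro: continuous_on_subset)
  then obtain L where L: "\<And>x. x \<in> {a..b} \<Longrightarrow> \<bar>f' x\<bar> \<le> L" "L > 0"
    unfolding bounded_pos by fastforce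
  then have "\<bar>f' x\<bar> \<le> L" for x
    using assms(3)[of x] by (cases "x \<in> {a..b}") auto
  then have "\<bar>f x - f y\<bar> \<le> L * \<bar>x - y\<bar>" for x y
    using field_differentiable_bound[of UNIV f f' L x y] assms(1) by auto
  with L(2) that show thesis by (auto intro: less_imp_le)
qed

lemma abs_le_compact_support:
  fixes f :: "real \<Rightarrow> real"
  assumes "continuous_on UNIV f" "\<And>x. x \<notin> {a..b} \<Longrightarrow> f x = 0"
  obtains M where "M \<ge> 0" "\<And>x. \<bar>f x\<bar> \<le> M"
proof -
  have "bounded (f ` {a..b})"
    using assms(1) by (intro compact_imp_bounded compact_continuous_image)
      (auto intro: continuous_on_subset)
  then obtain L where L: "\<And>x. x \<in> {a..b} \<Longrightarrow> \<bar>f x\<bar> \<le> L" "L > 0"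
    unfolding bounded_pos by fastforce
  then have "\<bar>f x\<bar> \<le> L" for x
    using assms(2)[of x] by (cases "x \<in> {a..b}") auto
  with L(2) that show thesis by (auto intro: less_imp_le)
qed

section \<open>Moments of weak solutions\<close>

lemma closure_Q: "closure Q = UNIV \<times> {0..}"
  by (simp add: Q_def closure_Times)

lemma holder_on_imp_continuous_on:
  assumes "holder_on \<alpha> \<beta> S f" "\<alpha> > 0" "\<beta> > 0"
  shows "continuous_on S f"
  unfolding continuous_on_def
proof
  fix p assume p: "p \<in> S"
  obtain L where L: "\<And>x t y s. (x, t) \<in> S \<Longrightarrow> (y, s) \<in> S \<Longrightarrow>
      \<bar>f (x, t) - f (y, s)\<bar> \<le> L * (\<bar>x - y\<bar> powr \<alpha> + \<bar>t - s\<bar> powr \<beta>)"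
    using assms(1) unfolding holder_on_def by blast
  have "((\<lambda>q. f q - f p) \<longlongrightarrow> 0) (at p within S)"
  proof (rule Lim_null_comparison)
    show "\<forall>\<^sub>F q in at p within S. norm (f q - f p) \<le>
        L * (\<bar>fst q - fst p\<bar> powr \<alpha> + \<bar>snd q - snd p\<bar> powr \<beta>)"
      using L[of "fst q" "snd q" "fst p" "snd p" for q] p
      by (auto simp: eventually_at_filter intro!: always_eventually)
    have "((\<lambda>q. \<bar>fst q - fst p\<bar> powr \<alpha>) \<longlongrightarrow> 0 powr \<alpha>) (at p within S)"
      "((\<lambda>q. \<bar>snd q - snd p\<bar> powr \<beta>) \<longlongrightarrow> 0 powr \<beta>) (at p within S)"
      using assms(2,3) by (auto intro!: tendsto_powr' tendsto_eq_intros always_eventually)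
    then show "((\<lambda>q. L * (\<bar>fst q - fst p\<bar> powr \<alpha> + \<bar>snd q - snd p\<bar> powr \<beta>)) \<longlongrightarrow> 0) (at p within S)"
      using tendsto_mult_right_zero[OF tendsto_add_zero] by simp
  qed
  then show "(f \<longlongrightarrow> f p) (at p within S)"
    by (simp add: LIM_zero_iff)
qed

lemma weak_solution_continuous_on:
  assumes "weak_solution u u0"
  shows "continuous_on (UNIV \<times> {0..}) u"
  using assms holder_on_imp_continuous_on[of "1/2" "1/8" "closure Q" u]
  by (simp add: weak_solution_def closure_Q)

lemma weak_solution_nonneg: "weak_solution u u0 \<Longrightarrow> t \<ge> 0 \<Longrightarrow> 0 \<le> u (x, t)"
  by (auto simp: weak_solution_def closure_Q)

section \<open>The weak formulation tested with a cut-off\<close>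

text \<open>Integrated over all times, so that one number serves every interval
  \<open>{0..b}\<close>. For weak solutions the integrand is integrable by the \<open>L2_on\<close>
  clause, so the default value 0 of a divergent integral does not arise.\<close>

definition dissipation :: "(real \<times> real \<Rightarrow> real) \<Rightarrow> real" where
  "dissipation u = (LINT p|lebesgue_on (P u). (sqrt (u p) * (dx ^^ 3) u p)\<^sup>2)"

lemma dissipation_nonneg: "0 \<le> dissipation u"
  unfolding dissipation_def by (rule Bochner_Integration.integral_nonneg) simp

definition weighted_mass :: "(real \<times> real \<Rightarrow> real) \<Rightarrow> (real \<Rightarrow> real) \<Rightarrow> real \<Rightarrow> real" where
  "weighted_mass u \<phi> t = (LINT x|lborel. u (x, t) * \<phi> x)"

text \<open>The bound on the square of \<open>\<phi>'\<close> is what closes the estimate: the flux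
  pairs u^(1/2) u_xxx with u^(1/2) \<open>\<phi>'\<close>, and the square of the latter is at most
  \<kappa> u \<phi>, the density of the weighted mass itself.\<close>

locale cutoff =
  fixes \<phi> \<phi>' :: "real \<Rightarrow> real" and R \<kappa> :: real
  assumes d\<phi>: "\<And>x. (\<phi> has_real_derivative \<phi>' x) (at x)" and c\<phi>': "continuous_on UNIV \<phi>'"
    and \<phi>0: "\<And>x. 0 \<le> \<phi> x" and \<phi>out: "\<And>x. x \<notin> {- R..R} \<Longrightarrow> \<phi> x = 0"
    and \<kappa>: "\<And>x. (\<phi>' x)\<^sup>2 \<le> \<kappa> * \<phi> x" and \<kappa>0: "0 < \<kappa>"

text \<open>The test function is \<phi>(x) \<eta>(t), where \<eta> rises to 1 just after time 0 and
  falls back just before \<open>b\<close>. The term with \<open>\<eta>'\<close> is close to G 0 - G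
  b, and the flux term is split by AM-GM with weight \<delta>.\<close>

lemma (in cutoff) weighted_mass_change:
  assumes weak: "weak_solution u u0"
  defines "G \<equiv> weighted_mass u \<phi>"
  shows "continuous_on {0..} G"
    "\<lbrakk>0 < b; 0 < \<delta>; \<And>t. t \<in> {0..b} \<Longrightarrow> G t \<le> S\<rbrakk> \<Longrightarrow>
      \<bar>G b - G 0\<bar> \<le> \<delta> * dissipation u / 2 + \<kappa> * b * S / (2 * \<delta>)"
proof -
  \<comment> \<open>Freezing the initial values for negative times gives a function that is
    continuous and nonnegative on the whole plane; \<open>u\<close> itself is unconstrained
    there.\<close>
  define v where "v p = u (fst p, max 0 (snd p))" for p
  have cv: "continuous_on UNIV v"
    unfolding v_def
    by (rule continuous_on_compose2[OF weak_solution_continuous_on[OF weak]]) (auto intro!: continuous_intros)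
  have vu: "v (x, t) = u (x, t)" if "t \<ge> 0" for x t using that by (simp add: v_def)
  have v0: "v p \<ge> 0" for p using weak_solution_nonneg[OF weak] by (simp add: v_def)
  have c\<phi>: "continuous_on UNIV \<phi>"
    using d\<phi> by (meson DERIV_continuous_on has_field_derivative_at_within)
  have \<phi>'out: "\<phi>' x = 0" if "x \<notin> {- R..R}" for x
    using \<kappa>[of x] \<phi>out[OF that] by simp
  note cs [continuous_intros] = continuous_on_compose2[OF cv] continuous_on_compose2[OF c\<phi>]
    continuous_on_compose2[OF c\<phi>'] continuous_on_compose2[OF continuous_on_hat[of UNIV]]
    continuous_on_compose2[OF continuous_on_smooth_step[of UNIV]]

  define g where "g t = (LINT x|lborel. v (x, t) * \<phi> x)" for t
  have gG: "g t = G t" if "t \<ge> 0" for t using that by (simp add: g_def G_def weighted_mass_def vu)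
  have g_int: "integrable lborel (\<lambda>x. v (x, t) * \<phi> x)" for t
    using \<phi>out by (intro integrable_compact_support[of _ "{- R..R}"] continuous_intros) auto
  have g0: "g t \<ge> 0" for t
    unfolding g_def using v0 \<phi>0 by (intro Bochner_Integration.integral_nonneg) simp
  have cg: "continuous_on UNIV g"
  proof -
    have "g t = integral (cbox (- R) R) (\<lambda>x. v (x, t) * \<phi> x)" for t
    proof -
      have "g t = integral UNIV (\<lambda>x. v (x, t) * \<phi> x)"
        unfolding g_def by (rule integral_lborel[symmetric, OF g_int])
      also have "(\<lambda>x. v (x, t) * \<phi> x) = (\<lambda>x. if x \<in> cbox (- R) R then v (x, t) * \<phi> x else 0)"
        using \<phi>out by (auto simp: fun_eq_iff)
      finally show ?thesis by (simp only: Henstock_Kurzweil_Integration.integral_restrict_UNIV)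
    qed
    moreover have "continuous_on UNIV (\<lambda>t. integral (cbox (- R) R) (\<lambda>x. v (x, t) * \<phi> x))"
      by (rule integral_continuous_on_param) (auto simp: split_beta intro!: continuous_intros)
    ultimately show ?thesis by simp
  qed
  show "continuous_on {0..} G"
    using continuous_on_subset[OF cg, of "{0..}"] continuous_on_cong[of "{0..}" "{0..}" g G] gG by simp

  assume b: "0 < b" and \<delta>: "0 < \<delta>" and S: "\<And>t. t \<in> {0..b} \<Longrightarrow> G t \<le> S"
  show "\<bar>G b - G 0\<bar> \<le> \<delta> * dissipation u / 2 + \<kappa> * b * S / (2 * \<delta>)"
  proof (rule field_le_epsilon)
    fix \<epsilon>2 :: real assume "\<epsilon>2 > 0"
    \<comment> \<open>Half of the error is allotted to each end of the time interval.\<close>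
    define \<epsilon> where "\<epsilon> = \<epsilon>2 / 2"
    have \<epsilon>: "\<epsilon> > 0" using \<open>\<epsilon>2 > 0\<close> by (simp add: \<epsilon>_def)
    have "\<exists>d>0. \<forall>t. \<bar>t - c\<bar> \<le> d \<longrightarrow> \<bar>g t - g c\<bar> \<le> \<epsilon>" for c
    proof -
      obtain d where "d > 0" "\<And>t. \<bar>t - c\<bar> < d \<Longrightarrow> \<bar>g t - g c\<bar> < \<epsilon>"
        using cg \<epsilon> unfolding continuous_on_iff dist_real_def by (metis UNIV_I)
      then show ?thesis by (intro exI[of _ "d / 2"]) (auto intro!: less_imp_le)
    qed
    then obtain d0 db where d: "d0 > 0" "\<And>t. \<bar>t - 0\<bar> \<le> d0 \<Longrightarrow> \<bar>g t - g 0\<bar> \<le> \<epsilon>"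
      "db > 0" "\<And>t. \<bar>t - b\<bar> \<le> db \<Longrightarrow> \<bar>g t - g b\<bar> \<le> \<epsilon>"
      by meson
    \<comment> \<open>The rise of \<eta> takes place on [h, 3 h], within \<open>d0\<close> of 0, and
      the fall on [b - 2 h, b], within \<open>db\<close> of \<open>b\<close>;
      \<open>6 * h \<le> b\<close> keeps the rise before the fall. Starting at \<open>h\<close>
      instead of 0 keeps the support inside the open set \<open>Q\<close>.\<close>
    define h where "h = min (min (d0 / 3) (db / 2)) (b / 6)"
    have h: "h > 0" "3 * h \<le> d0" "2 * h \<le> db" "6 * h \<le> b"
      using d(1,3) b by (auto simp: h_def)
    define \<eta> where "\<eta> t = smooth_step ((t - h) / h) - smooth_step ((t - (b - 2 * h)) / h)" for t
    define \<eta>' where "\<eta>' t = hat ((t - h) / h) / h - hat ((t - (b - 2 * h)) / h) / h" for t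
    have d\<eta>: "(\<eta> has_real_derivative \<eta>' t) (at t)" for t
      unfolding \<eta>_def \<eta>'_def by (intro DERIV_diff DERIV_smooth_step_scaled h)
    have c\<eta>: "continuous_on UNIV \<eta>" and c\<eta>': "continuous_on UNIV \<eta>'"
      unfolding \<eta>_def \<eta>'_def using h by (auto intro!: continuous_intros)
    have \<eta>out: "\<eta> t = 0" if "t \<notin> {h..b}" for t
    proof (cases "t < h")
      case True
      then have "(t - h) / h \<le> 0" "(t - (b - 2 * h)) / h \<le> 0"
        using h by (auto simp: divide_le_0_iff)
      then show ?thesis by (simp add: \<eta>_def smooth_step_eq_0)
    next
      case False
      then have "(t - h) / h \<ge> 2" "(t - (b - 2 * h)) / h \<ge> 2"
        using h that by (auto simp: field_simps)
      then show ?thesis by (simp add: \<eta>_def smooth_step_eq_1)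
    qed
    have \<eta>'out: "\<eta>' t = 0" if "t \<notin> {h..b}" for t
    proof (cases "t < h")
      case True
      then have "(t - h) / h \<le> 0" "(t - (b - 2 * h)) / h \<le> 0"
        using h by (auto simp: divide_le_0_iff)
      then show ?thesis by (simp add: \<eta>'_def hat_eq_0)
    next
      case False
      then have "(t - h) / h \<ge> 2" "(t - (b - 2 * h)) / h \<ge> 2"
        using h that by (auto simp: field_simps)
      then show ?thesis by (simp add: \<eta>'_def hat_eq_0)
    qed
    have \<eta>01: "0 \<le> \<eta> t \<and> \<eta> t \<le> 1" for t
    proof -
      have "(t - (b - 2 * h)) / h \<le> (t - h) / h"
        using h by (intro divide_right_mono) auto
      from smooth_step_mono[OF this] show ?thesis
        using smooth_step_nonneg[of "(t - (b - 2 * h)) / h"] smooth_step_le_1[of "(t - h) / h"]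
        by (simp add: \<eta>_def)
    qed
    note cs2 [continuous_intros] = continuous_on_compose2[OF c\<eta>] continuous_on_compose2[OF c\<eta>']

    define \<psi> where "\<psi> p = \<phi> (fst p) * \<eta> (snd p)" for p
    have supp: "closure {p. \<psi> p \<noteq> 0} \<subseteq> {- R..R} \<times> {h..b}"
      using \<phi>out \<eta>out by (intro closure_minimal closed_Times) (auto simp: \<psi>_def, fastforce+)
    have suppQ: "closure {p. \<psi> p \<noteq> 0} \<subseteq> Q"
      using supp h by (force simp: Q_def)
    have suppc: "compact (closure {p. \<psi> p \<noteq> 0})"
      using supp by (metis closed_closure compact_Icc compact_Int_closed compact_Times inf.absorb_iff2)
    have lip: "\<exists>L. L-lipschitz_on UNIV \<psi>"
    proof -
      obtain L1 where L1: "L1 \<ge> 0" "\<And>x y. \<bar>\<phi> x - \<phi> y\<bar> \<le> L1 * \<bar>x - y\<bar>"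
        using C1_compact_support_lipschitz[OF d\<phi> c\<phi>' \<phi>'out] by blast
      obtain L2 where L2: "L2 \<ge> 0" "\<And>x y. \<bar>\<eta> x - \<eta> y\<bar> \<le> L2 * \<bar>x - y\<bar>"
        using C1_compact_support_lipschitz[OF d\<eta> c\<eta>' \<eta>'out] by blast
      obtain M where M: "M \<ge> 0" "\<And>x. \<bar>\<phi> x\<bar> \<le> M"
        using abs_le_compact_support[OF c\<phi> \<phi>out] by blast
      have "\<bar>\<psi> p - \<psi> q\<bar> \<le> (L1 + M * L2) * dist p q" for p q
      proof -
        have "\<psi> p - \<psi> q = (\<phi> (fst p) - \<phi> (fst q)) * \<eta> (snd p) + \<phi> (fst q) * (\<eta> (snd p) - \<eta> (snd q))"
          by (simp add: \<psi>_def algebra_simps)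
        also have "\<bar>\<dots>\<bar> \<le> \<bar>\<phi> (fst p) - \<phi> (fst q)\<bar> * \<bar>\<eta> (snd p)\<bar> + \<bar>\<phi> (fst q)\<bar> * \<bar>\<eta> (snd p) - \<eta> (snd q)\<bar>"
          unfolding abs_mult[symmetric] by (rule abs_triangle_ineq)
        also have "\<dots> \<le> (L1 * \<bar>fst p - fst q\<bar>) * 1 + M * (L2 * \<bar>snd p - snd q\<bar>)"
          using L1 L2 M \<eta>01 by (intro add_mono mult_mono) (auto simp: abs_le_iff)
        also have "\<dots> \<le> (L1 * dist p q) * 1 + M * (L2 * dist p q)"
          using L1 L2 M dist_fst_le[of p q] dist_snd_le[of p q]
          by (intro add_mono mult_mono mult_nonneg_nonneg) (auto simp: dist_real_def)
        finally show ?thesis by (simp add: algebra_simps)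
      qed
      then have "(L1 + M * L2)-lipschitz_on UNIV \<psi>"
        using L1 L2 M by (intro lipschitz_onI) (auto simp: dist_real_def)
      then show ?thesis ..
    qed
    have dt\<psi>: "dt \<psi> (x, t) = \<phi> x * \<eta>' t" for x t
      unfolding dt_def \<psi>_def by (auto intro!: DERIV_imp_deriv DERIV_cmult d\<eta>)
    have dx\<psi>: "dx \<psi> (x, t) = \<phi>' x * \<eta> t" for x t
      unfolding dx_def \<psi>_def by (auto intro!: DERIV_imp_deriv DERIV_cmult_right d\<phi>)

    define I1 where "I1 = (LINT p|lebesgue_on Q. u p * dt \<psi> p)"
    define I2 where "I2 = (LINT p|lebesgue_on (P u). u p * (dx ^^ 3) u p * dx \<psi> p)"
    have "I1 + I2 = 0"
      using weak lip suppc suppQ unfolding weak_solution_def I1_def I2_def by blast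

    have openQ: "open Q" by (auto simp: Q_def intro!: open_Times)
    then have Qm: "Q \<inter> space lebesgue \<in> sets lebesgue"
      by (simp add: borel_open sets_completionI_sets)
    have fubini: "(LINT p|lborel. f p) = (LINT t|lborel. LINT x|lborel. f (x, t))"
      if "integrable lborel f" for f :: "real \<times> real \<Rightarrow> real"
      using that lborel_pair.integral_snd[of "\<lambda>x y. f (x, y)"]
      by (simp add: lborel_prod)
    \<comment> \<open>On \<open>Q\<close> this is the first integrand; off \<open>Q\<close> it
      vanishes because \<open>\<eta>'\<close> does. Being continuous with compact support, it is
      eligible for Fubini.\<close>
    define F where "F p = v p * \<phi> (fst p) * \<eta>' (snd p)" for p
    have cF: "continuous_on UNIV F"
      unfolding F_def by (auto intro!: continuous_intros)
    have Fi: "integrable lborel F"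
    proof (rule integrable_compact_support[OF cF, of "{- R..R} \<times> {h..b}"])
      show "F p = 0" if "p \<notin> {- R..R} \<times> {h..b}" for p
        using that \<phi>out[of "fst p"] \<eta>'out[of "snd p"] by (cases p) (auto simp: F_def)
    qed (simp add: compact_Times)
    have "I1 = (LINT p|lebesgue. indicator Q p *\<^sub>R (u p * dt \<psi> p))"
      unfolding I1_def by (rule integral_restrict_space[OF Qm])
    also have "\<dots> = (LINT p|lebesgue. F p)"
    proof (rule Bochner_Integration.integral_cong)
      fix p :: "real \<times> real"
      show "indicator Q p *\<^sub>R (u p * dt \<psi> p) = F p"
        using \<eta>'out[of "snd p"] h by (cases p) (auto simp: F_def dt\<psi> Q_def vu indicator_def)
    qed simp
    also have "\<dots> = (LINT p|lborel. F p)"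
      using borel_measurable_continuous_onI[OF cF] by (intro integral_completion) simp
    also have "\<dots> = (LINT t|lborel. LINT x|lborel. F (x, t))"
      by (rule fubini[OF Fi])
    also have "\<dots> = (LINT t|lborel. g t * \<eta>' t)"
      by (simp add: F_def g_def)
    also have "\<dots> = (LINT t|lborel. g t * (hat ((t - h) / h) / h)) -
        (LINT t|lborel. g t * (hat ((t - (b - 2 * h)) / h) / h))"
      unfolding \<eta>'_def right_diff_distrib
      by (intro Bochner_Integration.integral_diff integrable_mult_hat h cg)
    finally have I1: "I1 = \<dots>" .
    have "\<bar>(LINT t|lborel. g t * (hat ((t - h) / h) / h)) - g 0\<bar> \<le> \<epsilon>"
      using h by (intro hat_average cg d(2)) auto
    moreover have "\<bar>(LINT t|lborel. g t * (hat ((t - (b - 2 * h)) / h) / h)) - g b\<bar> \<le> \<epsilon>"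
      using h by (intro hat_average cg d(4)) auto
    ultimately have "\<bar>g b - g 0\<bar> \<le> \<bar>I1\<bar> + 2 * \<epsilon>" unfolding I1 by linarith

    \<comment> \<open>Expressed through the continuous function \<open>v\<close>, the positivity set
      is open and hence measurable.\<close>
    have "P u = Q \<inter> {p. v p \<noteq> 0}"
      by (auto simp: P_def Q_def vu)
    moreover have "open {p. v p \<noteq> 0}"
      using continuous_on_const cv by (intro open_Collect_neq) auto
    ultimately have Pm: "P u \<inter> space lebesgue \<in> sets lebesgue"
      using openQ by (simp add: borel_open open_Int sets_completionI_sets)
    \<comment> \<open>On \<open>P u\<close> the flux integrand factors as w z: \<open>w\<close> is
      square integrable by the definition of a weak solution, and \<open>z\<close> is continuous
      with compact support.\<close>
    define w where "w = (\<lambda>p. sqrt (u p) * (dx ^^ 3) u p)"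
    have wm: "w \<in> borel_measurable (lebesgue_on (P u))"
      and wi: "integrable (lebesgue_on (P u)) (\<lambda>p. (w p)\<^sup>2)"
      using weak unfolding weak_solution_def L2_on_def w_def by blast+
    define z where "z p = sqrt (v p) * (\<phi>' (fst p) * \<eta> (snd p))" for p
    have cz: "continuous_on UNIV z"
      unfolding z_def by (auto intro!: continuous_intros)
    have zP: "u p * (dx ^^ 3) u p * dx \<psi> p = w p * z p" if "p \<in> P u" for p
      using that v0[of p] by (cases p) (auto simp: P_def Q_def w_def z_def dx\<psi> vu)
    have zi: "integrable lborel (\<lambda>p. (z p)\<^sup>2)"
    proof (rule integrable_compact_support[of _ "{- R..R} \<times> {h..b}"])
      show "(z p)\<^sup>2 = 0" if "p \<notin> {- R..R} \<times> {h..b}" for p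
        using that \<phi>'out[of "fst p"] \<eta>out[of "snd p"] by (cases p) (auto simp: z_def)
    qed (simp_all add: compact_Times continuous_on_power cz)
    have zbor: "z \<in> borel_measurable borel" by (rule borel_measurable_continuous_onI[OF cz])
    have zi': "integrable lebesgue (\<lambda>p. (z p)\<^sup>2)"
      using zi zbor by (subst integrable_completion) auto
    have ziP: "integrable (lebesgue_on (P u)) (\<lambda>p. (z p)\<^sup>2)"
      unfolding integrable_restrict_space[OF Pm]
      using Pm by (intro integrable_mult_indicator zi') simp
    have zPm: "z \<in> borel_measurable (lebesgue_on (P u))"
      using zbor by (intro measurable_restrict_space1 measurable_completion) simp
    have wz: "\<bar>w p * z p\<bar> \<le> \<delta> / 2 * (w p)\<^sup>2 + (z p)\<^sup>2 / (2 * \<delta>)" for p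
    proof -
      have "4 * (\<delta> * \<bar>w p\<bar>) * \<bar>z p\<bar> \<le> (\<delta> * \<bar>w p\<bar> + \<bar>z p\<bar>)\<^sup>2" by (rule four_mult_le_square_add)
      then show ?thesis using \<delta> by (simp add: abs_mult power2_sum power_mult_distrib field_simps power2_eq_square)
    qed
    have wzi: "integrable (lebesgue_on (P u)) (\<lambda>p. \<delta> / 2 * (w p)\<^sup>2 + (z p)\<^sup>2 / (2 * \<delta>))"
      using wi ziP by auto
    have "I2 = (LINT p|lebesgue_on (P u). w p * z p)"
      unfolding I2_def using zP by (intro Bochner_Integration.integral_cong) (auto simp: space_restrict_space)
    also have "\<bar>\<dots>\<bar> \<le> (LINT p|lebesgue_on (P u). \<delta> / 2 * (w p)\<^sup>2 + (z p)\<^sup>2 / (2 * \<delta>))"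
    proof (rule integral_abs_bound_integral)
      show "integrable (lebesgue_on (P u)) (\<lambda>p. w p * z p)"
        using wz by (intro Bochner_Integration.integrable_bound[OF wzi] borel_measurable_times wm zPm AE_I2)
          (fastforce simp: real_norm_def intro: order_trans[OF _ abs_ge_self])
    qed (use wz wzi in auto)
    also have "\<dots> = \<delta> / 2 * dissipation u + (LINT p|lebesgue_on (P u). (z p)\<^sup>2) / (2 * \<delta>)"
      using wi ziP by (simp add: dissipation_def w_def)
    also have "(LINT p|lebesgue_on (P u). (z p)\<^sup>2) \<le> (LINT p|lborel. (z p)\<^sup>2)"
    proof -
      have "(LINT p|lebesgue_on (P u). (z p)\<^sup>2) = (LINT p|lebesgue. indicator (P u) p *\<^sub>R (z p)\<^sup>2)"
        by (rule integral_restrict_space[OF Pm])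
      also have "\<dots> \<le> (LINT p|lebesgue. (z p)\<^sup>2)"
        using Pm by (intro integral_mono zi' integrable_mult_indicator) (auto simp: indicator_def)
      also have "\<dots> = (LINT p|lborel. (z p)\<^sup>2)"
        using zbor by (intro integral_completion) auto
      finally show ?thesis .
    qed
    also have "(LINT p|lborel. (z p)\<^sup>2) \<le> \<kappa> * b * S"
    proof -
      \<comment> \<open>A majorant of z^2 whose integral over x is \<kappa> times
        \<open>g t * (\<eta> t)\<^sup>2\<close>, hence at most \<kappa> S for times in
        \<open>{0..b}\<close> and 0 for all others.\<close>
      define H where "H p = \<kappa> * (v p * \<phi> (fst p) * (\<eta> (snd p))\<^sup>2)" for p
      have cH: "continuous_on UNIV H"
        unfolding H_def by (auto intro!: continuous_intros)
      have Hi: "integrable lborel H"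
      proof (rule integrable_compact_support[OF cH, of "{- R..R} \<times> {h..b}"])
        show "H p = 0" if "p \<notin> {- R..R} \<times> {h..b}" for p
          using that \<phi>out[of "fst p"] \<eta>out[of "snd p"] by (cases p) (auto simp: H_def)
      qed (simp add: compact_Times)
      have "(LINT p|lborel. (z p)\<^sup>2) \<le> (LINT p|lborel. H p)"
      proof (rule integral_mono[OF zi Hi])
        fix p :: "real \<times> real"
        have "(z p)\<^sup>2 = (\<phi>' (fst p))\<^sup>2 * (v p * (\<eta> (snd p))\<^sup>2)"
          using v0[of p] by (simp add: z_def power_mult_distrib)
        also have "\<dots> \<le> \<kappa> * \<phi> (fst p) * (v p * (\<eta> (snd p))\<^sup>2)"
          using v0[of p] by (intro mult_right_mono \<kappa>) simp
        finally show "(z p)\<^sup>2 \<le> H p" by (simp add: H_def mult_ac)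
      qed
      also have "\<dots> = (LINT t|lborel. LINT x|lborel. H (x, t))"
        by (rule fubini[OF Hi])
      also have "\<dots> = (LINT t|lborel. \<kappa> * (g t * (\<eta> t)\<^sup>2))"
        by (simp add: H_def g_def)
      also have "\<dots> \<le> (LINT t|lborel. \<kappa> * S * indicator {0..b} t)"
      proof (rule integral_mono)
        show "integrable lborel (\<lambda>t. \<kappa> * (g t * (\<eta> t)\<^sup>2))"
          using \<eta>out by (intro integrable_compact_support[of _ "{h..b}"] continuous_intros cg c\<eta>) auto
        show "integrable lborel (\<lambda>t. \<kappa> * S * indicator {0..b} t)"
          using b by (intro integrable_mult_right) (simp add: integrable_indicator_iff)
        fix t
        show "\<kappa> * (g t * (\<eta> t)\<^sup>2) \<le> \<kappa> * S * indicator {0..b} t"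
        proof (cases "t \<in> {0..b}")
          case True
          have "g t * (\<eta> t)\<^sup>2 \<le> g t * 1"
            using \<eta>01[of t] g0[of t] by (intro mult_left_mono power_le_one) auto
          also have "\<dots> \<le> S" using S[OF True] gG[of t] True by simp
          finally show ?thesis using True \<kappa>0 by (simp add: mult_left_mono)
        next
          case False
          then show ?thesis using \<eta>out[of t] h by auto
        qed
      qed
      also have "\<dots> = \<kappa> * b * S" using b by simp
      finally show ?thesis .
    qed
    finally have "\<bar>I2\<bar> \<le> \<delta> / 2 * dissipation u + \<kappa> * b * S / (2 * \<delta>)"
      using \<delta> by (simp add: divide_right_mono)
    with \<open>\<bar>g b - g 0\<bar> \<le> \<bar>I1\<bar> + 2 * \<epsilon>\<close> \<open>I1 + I2 = 0\<close>
    show "\<bar>G b - G 0\<bar> \<le> \<delta> * dissipation u / 2 + \<kappa> * b * S / (2 * \<delta>) + \<epsilon>2"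
      using gG[of b] gG[of 0] b by (simp add: \<epsilon>_def)
  qed
qed

lemma (in cutoff) weighted_mass_nonneg:
  assumes "weak_solution u u0" "t \<ge> 0"
  shows "0 \<le> weighted_mass u \<phi> t"
  unfolding weighted_mass_def
  using weak_solution_nonneg[OF assms] \<phi>0 by (intro Bochner_Integration.integral_nonneg) simp

text \<open>A bound without a prior \<open>S\<close>: the change estimate is applied up to a time
  \<open>s\<close> where the weighted mass is maximal, with S = G s and \<delta> = \<kappa> s. The
  last term is then G s / 2 and is absorbed on the left. The case s = 0 is separate since \<delta>
  must be positive.\<close>

lemma (in cutoff) weighted_mass_le:
  assumes weak: "weak_solution u u0" and b: "b > 0" and t: "t \<in> {0..b}"
  shows "weighted_mass u \<phi> t \<le> 2 * weighted_mass u \<phi> 0 + \<kappa> * b * dissipation u"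
proof -
  define G where "G = weighted_mass u \<phi>"
  have "continuous_on {0..b} G"
    using weighted_mass_change(1)[OF weak] unfolding G_def by (rule continuous_on_subset) auto
  then obtain s where s: "s \<in> {0..b}" "\<And>t. t \<in> {0..b} \<Longrightarrow> G t \<le> G s"
    using continuous_attains_sup[of "{0..b}" G] b by auto
  have G0: "0 \<le> G t" if "t \<ge> 0" for t
    unfolding G_def by (rule weighted_mass_nonneg[OF weak that])
  have "G s \<le> 2 * G 0 + \<kappa> * b * dissipation u"
  proof (cases "s = 0")
    case True
    then show ?thesis using G0[of 0] \<kappa>0 b dissipation_nonneg[of u] by simp
  next
    case False
    then have s0: "s > 0" using s(1) by auto
    have "\<bar>G s - G 0\<bar> \<le> (\<kappa> * s) * dissipation u / 2 + \<kappa> * s * G s / (2 * (\<kappa> * s))"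
      unfolding G_def
      by (rule weighted_mass_change(2)[OF weak]) (use s0 s \<kappa>0 in \<open>auto simp: G_def\<close>)
    also have "\<kappa> * s * G s / (2 * (\<kappa> * s)) = G s / 2"
      using s0 \<kappa>0 by simp
    finally have "G s \<le> 2 * G 0 + \<kappa> * s * dissipation u" by linarith
    also have "\<kappa> * s * dissipation u \<le> \<kappa> * b * dissipation u"
      using s(1) \<kappa>0 dissipation_nonneg[of u] by (intro mult_right_mono) auto
    finally show ?thesis by simp
  qed
  with s(2)[OF t] show ?thesis by (simp add: G_def)
qed

section \<open>The two concrete cut-offs\<close>

lemma square_le_1_if_max_neq_0:
  fixes x r :: real
  assumes "max 0 (1 - (x / r)\<^sup>2) \<noteq> 0"
  shows "(x / r)\<^sup>2 \<le> 1"
  using assms by (cases "(x / r)\<^sup>2 \<le> 1") (auto simp: max_def)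

text \<open>The squared derivative is the right-hand side times (x/r)^2, which is at most 1 on the
  support. The decay of the constant in \<open>r\<close> is what later gives exact conservation of
  mass.\<close>

lemma cutoff_bump:
  assumes "r > 0"
  shows "cutoff (bump r) (\<lambda>x. 2 * max 0 (1 - (x / r)\<^sup>2) * (- 2 * x / r\<^sup>2)) r (16 / r\<^sup>2)"
proof
  show "(2 * max 0 (1 - (x / r)\<^sup>2) * (- 2 * x / r\<^sup>2))\<^sup>2 \<le> 16 / r\<^sup>2 * bump r x" for x
  proof (cases "max 0 (1 - (x / r)\<^sup>2) = 0")
    case False
    have "(2 * max 0 (1 - (x / r)\<^sup>2) * (- 2 * x / r\<^sup>2))\<^sup>2 = 16 / r\<^sup>2 * bump r x * (x / r)\<^sup>2"
      by (simp add: bump_def power2_eq_square)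
    also have "\<dots> \<le> 16 / r\<^sup>2 * bump r x * 1"
      using square_le_1_if_max_neq_0[OF False] by (intro mult_left_mono) auto
    finally show ?thesis by simp
  qed simp
  show "(bump r has_real_derivative 2 * max 0 (1 - (x / r)\<^sup>2) * (- 2 * x / r\<^sup>2)) (at x)" for x
    by (rule DERIV_bump[OF assms])
qed (use assms in \<open>auto intro!: bump_outside continuous_intros\<close>)

text \<open>With m the positive part and y = (x/r)^2, both in [0, 1] on the support, the last factor
  m - 2 y has modulus at most 2. The growth of x^2 is compensated exactly, so the constant does not
  depend on \<open>r\<close>.\<close>

lemma cutoff_square_bump:
  assumes "r > 0"
  shows "cutoff (\<lambda>x. x\<^sup>2 * bump r x)
    (\<lambda>x. 2 * x * max 0 (1 - (x / r)\<^sup>2) * (max 0 (1 - (x / r)\<^sup>2) - 2 * (x / r)\<^sup>2)) r 16"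
proof
  show "(2 * x * max 0 (1 - (x / r)\<^sup>2) * (max 0 (1 - (x / r)\<^sup>2) - 2 * (x / r)\<^sup>2))\<^sup>2
    \<le> 16 * (x\<^sup>2 * bump r x)" for x
  proof (cases "max 0 (1 - (x / r)\<^sup>2) = 0")
    case False
    define m where "m = max 0 (1 - (x / r)\<^sup>2)"
    have m: "0 \<le> m" "m \<le> 1" and y: "(x / r)\<^sup>2 \<le> 1" "0 \<le> (x / r)\<^sup>2"
      using square_le_1_if_max_neq_0[OF False] by (auto simp: m_def)
    have "\<bar>m - 2 * (x / r)\<^sup>2\<bar> \<le> 2"
      using m y by linarith
    then have "(m - 2 * (x / r)\<^sup>2)\<^sup>2 \<le> 2\<^sup>2"
      by (simp only: abs_le_square_iff[symmetric])
    then have "(4 * x\<^sup>2 * m\<^sup>2) * (m - 2 * (x / r)\<^sup>2)\<^sup>2 \<le> (4 * x\<^sup>2 * m\<^sup>2) * 2\<^sup>2"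
      by (intro mult_left_mono) auto
    moreover have "(2 * x * m * (m - 2 * (x / r)\<^sup>2))\<^sup>2 = (4 * x\<^sup>2 * m\<^sup>2) * (m - 2 * (x / r)\<^sup>2)\<^sup>2"
      by (simp add: power_mult_distrib)
    ultimately show ?thesis
      by (simp add: bump_def flip: m_def)
  qed simp
  show "((\<lambda>x. x\<^sup>2 * bump r x) has_real_derivative
    2 * x * max 0 (1 - (x / r)\<^sup>2) * (max 0 (1 - (x / r)\<^sup>2) - 2 * (x / r)\<^sup>2)) (at x)" for x
    by (rule DERIV_square_bump[OF assms])
qed (use assms in \<open>auto intro!: bump_outside continuous_intros\<close>)

section \<open>Removing the cut-off: second moment and mass\<close>

lemma bump_mono:
  assumes "0 < r" "r \<le> s"
  shows "bump r x \<le> bump s x"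
proof -
  have "(x / s)\<^sup>2 \<le> (x / r)\<^sup>2"
    using assms by (simp add: power_divide frac_le power_mono)
  then show ?thesis
    unfolding bump_def by (intro power_mono) auto
qed

lemma tendsto_bump: "(\<lambda>n. bump (real (Suc n)) x) \<longlonglongrightarrow> 1"
proof -
  have "(\<lambda>n. x / real (Suc n)) \<longlonglongrightarrow> 0"
    using LIMSEQ_Suc[OF lim_const_over_n[of x]] by simp
  then have "(\<lambda>n. (max 0 (1 - (x / real (Suc n))\<^sup>2))\<^sup>2) \<longlonglongrightarrow> (max 0 (1 - 0\<^sup>2))\<^sup>2"
    by (intro tendsto_intros)
  then show ?thesis by (simp add: bump_def)
qed

lemma weak_solution_slice:
  assumes "weak_solution u u0" "t \<ge> 0"
  shows "(\<lambda>x. u (x, t)) \<in> borel_measurable borel" "continuous_on UNIV (\<lambda>x. u (x, t))"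
proof -
  show "continuous_on UNIV (\<lambda>x. u (x, t))"
    by (rule continuous_on_compose2[OF weak_solution_continuous_on[OF assms(1)]])
      (use assms(2) in \<open>auto intro!: continuous_intros\<close>)
  then show "(\<lambda>x. u (x, t)) \<in> borel_measurable borel"
    by (rule borel_measurable_continuous_onI)
qed

text \<open>Monotone convergence: bumps of growing radius increase to 1. The radius
  \<open>Suc n\<close> avoids division by zero.\<close>

lemma integrable_of_bounded_cutoffs:
  fixes f :: "real \<Rightarrow> real"
  assumes [measurable]: "f \<in> borel_measurable borel" and f0: "\<And>x. 0 \<le> f x"
    and int: "\<And>n. integrable lborel (\<lambda>x. f x * bump (real (Suc n)) x)"
    and bd: "\<And>n. (LINT x|lborel. f x * bump (real (Suc n)) x) \<le> M"
  shows "integrable lborel f"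
    "(\<lambda>n. LINT x|lborel. f x * bump (real (Suc n)) x) \<longlonglongrightarrow> (LINT x|lborel. f x)"
proof -
  define I where "I n = (LINT x|lborel. f x * bump (real (Suc n)) x)" for n
  have mono: "mono (\<lambda>n. f x * bump (real (Suc n)) x)" for x
    by (intro monoI mult_left_mono bump_mono f0) auto
  have "I m \<le> I n" if "m \<le> n" for m n
    unfolding I_def using monoD[OF mono that] by (intro integral_mono int)
  then have "incseq I" by (simp add: incseq_def)
  then obtain L where L: "I \<longlonglongrightarrow> L"
    using incseq_convergent[of I M] bd unfolding I_def by blast
  have lim: "(\<lambda>n. f x * bump (real (Suc n)) x) \<longlonglongrightarrow> f x" for x
    using tendsto_mult_left[OF tendsto_bump, of "f x" x] by simp
  have "has_bochner_integral lborel f L"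
    by (rule has_bochner_integral_monotone_convergence[OF int _ _ L[unfolded I_def]])
      (rule AE_I2 mono lim | simp)+
  then show "integrable lborel f"
    "(\<lambda>n. LINT x|lborel. f x * bump (real (Suc n)) x) \<longlonglongrightarrow> (LINT x|lborel. f x)"
    using L unfolding I_def has_bochner_integral_iff by simp_all
qed

lemma integrable_mult_bump:
  assumes "continuous_on UNIV f" "r > 0"
  shows "integrable lborel (\<lambda>x. f x * bump r x)"
  by (rule integrable_compact_support[of _ "{- r..r}"])
    (use assms in \<open>auto intro!: continuous_intros bump_outside\<close>)

text \<open>As \<kappa> = 16 for every radius, \<open>weighted_mass_le\<close> bounds all truncated
  moments by twice the initial moment plus 16 t times the dissipation.\<close>

lemma weak_solution_second_moment_finite:
  assumes weak: "weak_solution u u0" and t: "t > 0"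
    and int: "integrable lborel (\<lambda>x. x\<^sup>2 * u (x, 0))"
  shows "integrable lborel (\<lambda>x. x\<^sup>2 * u (x, t))"
proof -
  have cont: "continuous_on UNIV (\<lambda>x. x\<^sup>2 * u (x, s))" if "s \<ge> 0" for s
    by (intro continuous_intros weak_solution_slice(2)[OF weak that])
  have wm: "weighted_mass u (\<lambda>x. x\<^sup>2 * bump r x) s = (LINT x|lborel. (x\<^sup>2 * u (x, s)) * bump r x)" for r s
    by (simp add: weighted_mass_def mult_ac)
  show ?thesis
  proof (rule integrable_of_bounded_cutoffs(1))
    show "(\<lambda>x. x\<^sup>2 * u (x, t)) \<in> borel_measurable borel"
      using t by (intro borel_measurable_continuous_onI cont) simp
    show "0 \<le> x\<^sup>2 * u (x, t)" for x using weak_solution_nonneg[OF weak] t by simp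
    show "integrable lborel (\<lambda>x. x\<^sup>2 * u (x, t) * bump (real (Suc n)) x)" for n
      using t by (intro integrable_mult_bump cont) auto
    fix n
    interpret cutoff "\<lambda>x. x\<^sup>2 * bump (real (Suc n)) x"
      "\<lambda>x. 2 * x * max 0 (1 - (x / real (Suc n))\<^sup>2) * (max 0 (1 - (x / real (Suc n))\<^sup>2) - 2 * (x / real (Suc n))\<^sup>2)"
      "real (Suc n)" 16
      by (rule cutoff_square_bump) simp
    have "(LINT x|lborel. x\<^sup>2 * u (x, t) * bump (real (Suc n)) x)
        \<le> 2 * (LINT x|lborel. x\<^sup>2 * u (x, 0) * bump (real (Suc n)) x) + 16 * t * dissipation u"
      using weighted_mass_le[OF weak t, of t] t unfolding wm by simp
    also have "(LINT x|lborel. x\<^sup>2 * u (x, 0) * bump (real (Suc n)) x) \<le> (LINT x|lborel. x\<^sup>2 * u (x, 0))"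
    proof (rule integral_mono[OF _ int])
      show "integrable lborel (\<lambda>x. x\<^sup>2 * u (x, 0) * bump (real (Suc n)) x)"
        by (intro integrable_mult_bump cont) auto
      show "x\<^sup>2 * u (x, 0) * bump (real (Suc n)) x \<le> x\<^sup>2 * u (x, 0)" for x
        using weak_solution_nonneg[OF weak, of 0 x] bump_le_1 by (simp add: mult_left_le)
    qed
    finally show "(LINT x|lborel. x\<^sup>2 * u (x, t) * bump (real (Suc n)) x)
        \<le> 2 * (LINT x|lborel. x\<^sup>2 * u (x, 0)) + 16 * t * dissipation u" by simp
  qed
qed

lemma weak_solution_mass_conserved:
  assumes weak: "weak_solution u u0" and t: "t > 0"
    and int: "integrable lborel (\<lambda>x. u (x, 0))"
  shows "has_bochner_integral lborel (\<lambda>x. u (x, t)) (LINT x|lborel. u (x, 0))"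
proof -
  define m where "m = (LINT x|lborel. u (x, 0))"
  define K where "K = dissipation u"
  define I where "I s n = (LINT x|lborel. u (x, s) * bump (real (Suc n)) x)" for s n
  have intb: "integrable lborel (\<lambda>x. u (x, s) * bump (real (Suc n)) x)" if "s \<ge> 0" for s n
    using that by (intro integrable_mult_bump weak_solution_slice(2)[OF weak]) auto
  have I0: "I 0 n \<le> m" for n
    unfolding I_def m_def
  proof (rule integral_mono[OF intb int])
    show "u (x, 0) * bump (real (Suc n)) x \<le> u (x, 0)" for x
      using weak_solution_nonneg[OF weak, of 0 x] bump_le_1 by (simp add: mult_left_le)
  qed simp
  have change: "\<bar>I t n - I 0 n\<bar> \<le> K / (2 * real (Suc n)) + 8 * t * (2 * m + 16 * t * K) / real (Suc n)"
    and bound: "I t n \<le> 2 * m + 16 * t * K" for n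
  proof -
    define r where "r = real (Suc n)"
    have r: "r \<ge> 1" by (simp add: r_def)
    interpret cutoff "bump r" "\<lambda>x. 2 * max 0 (1 - (x / r)\<^sup>2) * (- 2 * x / r\<^sup>2)" r "16 / r\<^sup>2"
      by (rule cutoff_bump) (use r in simp)
    have wm: "weighted_mass u (bump r) s = I s n" for s
      by (simp add: weighted_mass_def I_def r_def)
    \<comment> \<open>A bound uniform in the radius (here r >= 1) is needed first; it serves as
      \<open>S\<close> in the change estimate below.\<close>
    have "16 / r\<^sup>2 * t * K \<le> 16 * t * K"
      using r t dissipation_nonneg[of u]
      by (intro mult_right_mono) (auto simp: K_def divide_le_eq one_le_power)
    then have S: "weighted_mass u (bump r) s \<le> 2 * m + 16 * t * K" if "s \<in> {0..t}" for s
      using weighted_mass_le[OF weak t that] I0[of n] unfolding wm K_def by linarith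
    from S[of t] show "I t n \<le> 2 * m + 16 * t * K" using t by (simp add: wm)
    \<comment> \<open>The choice \<delta> = 1/r balances the terms: dissipation contributes K/(2 r),
      and 16/r^2 multiplied by r/2 leaves 8/r, so both vanish in the limit.\<close>
    have "\<bar>weighted_mass u (bump r) t - weighted_mass u (bump r) 0\<bar>
        \<le> 1 / r * dissipation u / 2 + 16 / r\<^sup>2 * t * (2 * m + 16 * t * K) / (2 * (1 / r))"
      by (rule weighted_mass_change(2)[OF weak t]) (use r S in auto)
    also have "\<dots> = K / (2 * r) + 8 * t * (2 * m + 16 * t * K) / r"
      using r by (simp add: K_def power2_eq_square field_simps)
    finally show "\<bar>I t n - I 0 n\<bar> \<le> K / (2 * real (Suc n)) + 8 * t * (2 * m + 16 * t * K) / real (Suc n)"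
      unfolding wm by (simp add: r_def)
  qed
  have lim: "I s \<longlonglongrightarrow> (LINT x|lborel. u (x, s))" and inte: "integrable lborel (\<lambda>x. u (x, s))"
    if "s \<ge> 0" "\<And>n. I s n \<le> M" for s M
    unfolding I_def using that weak_solution_slice[OF weak that(1)] weak_solution_nonneg[OF weak that(1)]
    by (intro integrable_of_bounded_cutoffs[of "\<lambda>x. u (x, s)" M] intb; simp add: I_def)+
  have "(\<lambda>n. K / 2 * (1 / real (Suc n)) + 8 * t * (2 * m + 16 * t * K) * (1 / real (Suc n))) \<longlonglongrightarrow> 0"
    by (intro tendsto_add_zero tendsto_mult_right_zero LIMSEQ_Suc[OF lim_const_over_n])
  then have "(\<lambda>n. I t n - I 0 n) \<longlonglongrightarrow> 0"
    by (rule Lim_null_comparison[rotated]) (use change in simp)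
  moreover have "(\<lambda>n. I t n - I 0 n) \<longlonglongrightarrow> (LINT x|lborel. u (x, t)) - m"
    unfolding m_def using t by (intro tendsto_diff lim[of _ m] lim[OF _ bound] I0) auto
  ultimately have "(LINT x|lborel. u (x, t)) = m"
    using LIMSEQ_unique by fastforce
  moreover have "integrable lborel (\<lambda>x. u (x, t))"
    using t by (intro inte[OF _ bound]) simp
  ultimately show ?thesis by (simp add: has_bochner_integral_iff m_def)
qed

section \<open>From time slices to the entropy inequality\<close>

text \<open>A zero second moment would force f = 0 almost everywhere, the point 0 being a null set,
  against unit mass. Positivity is what makes the Barenblatt parameters well defined.\<close>

lemma second_moment_pos:
  fixes f :: "real \<Rightarrow> real"
  assumes "has_bochner_integral lborel f 1" and f0: "\<And>x. 0 \<le> f x"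
    and int: "integrable lborel (\<lambda>x. x\<^sup>2 * f x)"
  shows "0 < (LINT x|lborel. x\<^sup>2 * f x)"
proof -
  have "(LINT x|lborel. x\<^sup>2 * f x) \<noteq> 0"
  proof
    assume "(LINT x|lborel. x\<^sup>2 * f x) = 0"
    then have "AE x in lborel. x\<^sup>2 * f x = 0"
      using integral_nonneg_eq_0_iff_AE[OF int] f0 by auto
    moreover have "AE x in lborel. x \<noteq> (0::real)"
      by (rule AE_lborel_singleton)
    ultimately have "AE x in lborel. f x = 0"
      by eventually_elim simp
    then have "(LINT x|lborel. f x) = 0" by (rule integral_eq_zero_AE)
    with assms(1) show False by (simp add: has_bochner_integral_iff)
  qed
  moreover have "0 \<le> (LINT x|lborel. x\<^sup>2 * f x)"
    using f0 by (intro Bochner_Integration.integral_nonneg) simp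
  ultimately show ?thesis by simp
qed

text \<open>A positive finite integral selects the real-valued branch of \<open>renyi\<close>, so
  differences of such entropies are ordinary real differences.\<close>

lemma renyi_eq_ln:
  assumes "has_bochner_integral lborel (\<lambda>x. f x powr (3/2)) J" "J > 0"
  shows "renyi f = ereal (- 2 * ln J)"
proof -
  have [measurable]: "(\<lambda>x. f x powr (3/2)) \<in> borel_measurable borel"
    using assms(1) by (auto simp: has_bochner_integral_iff dest: borel_measurable_integrable)
  have "(\<integral>\<^sup>+x. ennreal (f x powr (3/2)) \<partial>lebesgue) = (\<integral>\<^sup>+x. ennreal (f x powr (3/2)) \<partial>lborel)"
    by (rule nn_integral_completion)
  also have "\<dots> = ennreal J"
    using assms(1) by (subst nn_integral_eq_integral) (auto simp: has_bochner_integral_iff)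
  finally show ?thesis
    using assms(2) by (simp add: renyi_def Let_def ennreal_eq_0_iff)
qed

text \<open>Boundedness gives f^(3/2) <= M^(1/2) f and hence a finite \<open>Jf\<close>. The
  relative entropy is then the real number 2 ln (Jf / JB), on which \<open>real_of_ereal\<close> is
  faithful, and \<open>le_sqrt_two_ln\<close> converts the gap estimate.\<close>

lemma L1_le_relative_renyi:
  fixes f :: "real \<Rightarrow> real"
  assumes [measurable]: "f \<in> borel_measurable borel" and f0: "\<And>x. 0 \<le> f x" and fM: "\<And>x. f x \<le> M"
    and f1: "has_bochner_integral lborel f 1"
    and f2: "has_bochner_integral lborel (\<lambda>x. x\<^sup>2 * f x) \<theta>" and \<theta>: "\<theta> > 0" "\<theta>0 > 0"
  defines "B \<equiv> barenblatt_profile \<theta>0 \<theta>"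
  shows "(\<integral>\<^sup>+x. ennreal \<bar>f x - B x\<bar> \<partial>lebesgue)
       \<le> ennreal (15 / 2 * sqrt (real_of_ereal (relative_renyi f B)))"
proof -
  obtain A r where A: "A > 0" "r > 0" "A * r = 15 / 16"
    and B: "B = (\<lambda>x. A * bump r x)"
    and B1: "has_bochner_integral lborel (\<lambda>x. A * bump r x) 1"
    and B2: "has_bochner_integral lborel (\<lambda>x. x\<^sup>2 * (A * bump r x)) \<theta>"
    using barenblatt_profile_eq[OF \<theta>(2,1)] unfolding B_def by blast
  have "f x powr (3/2) = f x powr (1/2) * f x" for x
    using f0[of x] powr_add[of "f x" "1/2" 1] by simp
  moreover have "f x powr (1/2) \<le> M powr (1/2)" for x
    by (intro powr_mono2 f0 fM) simp
  ultimately have le: "f x powr (3/2) \<le> M powr (1/2) * f x" for x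
    using f0[of x] by (simp add: mult_right_mono)
  have "integrable lborel (\<lambda>x. f x powr (3/2))"
    by (rule Bochner_Integration.integrable_bound[of _ "\<lambda>x. M powr (1/2) * f x"])
      (use f1 le f0 in \<open>auto simp: has_bochner_integral_iff\<close>)
  then obtain Jf where Jf: "has_bochner_integral lborel (\<lambda>x. f x powr (3/2)) Jf"
    using has_bochner_integral_integrable by blast
  obtain JB where JB: "has_bochner_integral lborel (\<lambda>x. B x powr (3/2)) JB" "JB > 0" "Jf \<ge> JB"
    and gap: "(LINT x|lborel. \<bar>f x - B x\<bar>) \<le> 15 / 2 * sqrt (Jf / JB - 1)"
    using renyi_integral_gap[OF A assms(1) f0 f1 B1 f2 B2 Jf] unfolding B by blast
  have rr: "real_of_ereal (relative_renyi f B) = 2 * ln (Jf / JB)"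
    using JB by (simp add: relative_renyi_def renyi_eq_ln[OF Jf] renyi_eq_ln[OF JB(1)] ln_div algebra_simps)
  have B0: "0 \<le> B x" for x using A by (simp add: B)
  have Bi: "has_bochner_integral lborel B 1" using B1 by (simp add: B)
  \<comment> \<open>The trivial bound by the two masses covers the case where Jf / JB is
    large.\<close>
  have "(LINT x|lborel. \<bar>f x - B x\<bar>) \<le> (LINT x|lborel. f x + B x)"
    using f1 Bi f0 B0 by (intro integral_mono) (auto simp: has_bochner_integral_iff abs_le_iff)
  also have "\<dots> = 2" using f1 Bi by (simp add: has_bochner_integral_iff)
  finally have "(LINT x|lborel. \<bar>f x - B x\<bar>) \<le> 15 / 2 * sqrt (2 * ln (Jf / JB))"
    using gap JB by (intro le_sqrt_two_ln) auto
  moreover have "(\<integral>\<^sup>+x. ennreal \<bar>f x - B x\<bar> \<partial>lebesgue) = ennreal (LINT x|lborel. \<bar>f x - B x\<bar>)"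
  proof -
    have [measurable]: "B \<in> borel_measurable borel" unfolding B by measurable
    have "(\<integral>\<^sup>+x. ennreal \<bar>f x - B x\<bar> \<partial>lebesgue) = (\<integral>\<^sup>+x. ennreal \<bar>f x - B x\<bar> \<partial>lborel)"
      by (rule nn_integral_completion)
    also have "\<dots> = ennreal (LINT x|lborel. \<bar>f x - B x\<bar>)"
      using f1 Bi by (intro nn_integral_eq_integral) (auto simp: has_bochner_integral_iff)
    finally show ?thesis .
  qed
  ultimately show ?thesis by (simp add: rr ennreal_leI)
qed

theorem mainTheorem2:
  shows "\<exists>C>0. \<forall>(u :: real \<times> real \<Rightarrow> real) (u0 :: real \<Rightarrow> real) (\<Theta>0 :: real).
    strong_solution u u0 \<longrightarrow>
    has_bochner_integral lebesgue u0 1 \<longrightarrow>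
    has_bochner_integral lebesgue (\<lambda>x. x * u0 x) 0 \<longrightarrow>
    has_bochner_integral lebesgue (\<lambda>x. x\<^sup>2 * u0 x) \<Theta>0 \<longrightarrow>
    renyi u0 < \<infinity> \<longrightarrow>
    (\<forall>t>0. (\<integral>\<^sup>+x. ennreal \<bar>u (x, t) - U32 u t x\<bar> \<partial>lebesgue)
       \<le> ennreal (C * sqrt (real_of_ereal (relative_renyi (\<lambda>x. u (x, t)) (U32 u t)))))"
proof (intro exI[of _ "15 / 2"] conjI allI impI)
  \<comment> \<open>The constant is 4 A r = 15/4, doubled by taking e = sqrt y in e + y/e;
    \<open>A * r\<close> is the same for every profile, so neither \<open>u\<close> nor
    \<open>t\<close> enters.\<close>
  show "(0::real) < 15 / 2" by simp
  fix u :: "real \<times> real \<Rightarrow> real" and u0 :: "real \<Rightarrow> real" and \<Theta>0 t :: real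
  assume "strong_solution u u0" and mass: "has_bochner_integral lebesgue u0 1"
    and mom: "has_bochner_integral lebesgue (\<lambda>x. x\<^sup>2 * u0 x) \<Theta>0" and t: "t > 0"
  then have weak: "weak_solution u u0" by (simp add: strong_solution_def)
  then have u0: "u0 = (\<lambda>x. u (x, 0))" by (simp add: weak_solution_def fun_eq_iff)
  note m0 [measurable] = weak_solution_slice(1)[OF weak, of 0, simplified]
  have mt [measurable]: "(\<lambda>x. u (x, t)) \<in> borel_measurable borel"
    using weak_solution_slice(1)[OF weak, of t] t by simp
  have mass0: "has_bochner_integral lborel (\<lambda>x. u (x, 0)) 1"
    using mass unfolding u0 by (simp add: has_bochner_integral_lebesgue)
  have mom0: "has_bochner_integral lborel (\<lambda>x. x\<^sup>2 * u (x, 0)) \<Theta>0"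
    using mom unfolding u0 by (simp add: has_bochner_integral_lebesgue)
  have mass_t: "has_bochner_integral lborel (\<lambda>x. u (x, t)) 1"
    using weak_solution_mass_conserved[OF weak t] mass0 by (simp add: has_bochner_integral_iff)
  have mom_t: "integrable lborel (\<lambda>x. x\<^sup>2 * u (x, t))"
    using weak_solution_second_moment_finite[OF weak t] mom0 by (simp add: has_bochner_integral_iff)
  have sm: "second_moment (\<lambda>x. u (x, s)) = (LINT x|lborel. x\<^sup>2 * u (x, s))" if "s = 0 \<or> s = t" for s
    unfolding second_moment_def using that by (intro integral_completion) auto
  obtain M where M: "\<And>x. u (x, t) \<le> M"
  proof -
    have "bounded (u ` closure Q)"
      using weak by (simp add: weak_solution_def holder_on_def)
    then obtain M where "\<forall>p\<in>closure Q. \<bar>u p\<bar> \<le> M"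
      by (auto simp: bounded_iff)
    then have "u (x, t) \<le> M" for x
      using t by (simp add: closure_Q abs_le_iff)
    then show thesis by (rule that)
  qed
  show "(\<integral>\<^sup>+x. ennreal \<bar>u (x, t) - U32 u t x\<bar> \<partial>lebesgue)
       \<le> ennreal (15 / 2 * sqrt (real_of_ereal (relative_renyi (\<lambda>x. u (x, t)) (U32 u t))))"
    unfolding U32_def
  proof (rule L1_le_relative_renyi[OF mt _ M mass_t])
    show "0 \<le> u (x, t)" for x using weak_solution_nonneg[OF weak] t by simp
    then show "second_moment (\<lambda>x. u (x, t)) > 0"
      using second_moment_pos[OF mass_t _ mom_t] by (simp add: sm)
    show "second_moment (\<lambda>x. u (x, 0)) > 0"
      using second_moment_pos[OF mass0 weak_solution_nonneg[OF weak]] mom0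
      by (simp add: sm has_bochner_integral_iff)
    show "has_bochner_integral lborel (\<lambda>x. x\<^sup>2 * u (x, t)) (second_moment (\<lambda>x. u (x, t)))"
      using mom_t by (simp add: sm has_bochner_integral_iff)
  qed
qed

end
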